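(* Let $m \geq n$, $A \in \mathbb{C}^{m\times m}$ and $B \in \mathbb{C}^{n \times n}$ be normal matrices, and let $X \in \mathbb{C}^{m\times n}$ satisfy $AX - XB = F$. Let $z_0, \eta \in \mathbb{R}$ with $0 < \eta < z_0$, let $E = \{ z \in \mathbb{C} : |z - z_0| \leq \eta\}$, and suppose that every eigenvalue of $A$ lies in $E$ and every eigenvalue of $B$ lies in $-E = \{-z : z \in E\}$. Set $\phi = \sqrt{z_0^2 - \eta^2}$ and $\mu_1 = (z_0 + \phi)/(z_0 - \phi)$. Suppose that there is a constant $K \geq 1$ such that $\sigma_{j+1}(F) \leq K \mu_1^{-j} \|F\|_2$ for all $0 \leq j < n$. Then for every triangular number $t = k(k+1)/2$ (with $k$ a positive integer) satisfying $1 \leq t < n$, \[ \sigma_{t+1}(X) \leq K\, \frac{z_0+\eta}{z_0-\eta}\, \left(\tfrac{3}{2}\sqrt{t} + 1\right) \mu_1^{-(\sqrt{8t+1}-1)/2}\, \|X\|_2 . \]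
   Context: For a matrix $M$, $\sigma_j(M)$ denotes its $j$th largest singular value, with $\sigma_j(M) = 0$ if $j$ exceeds the smaller dimension of $M$, and $\|M\|_2 = \sigma_1(M)$ is the spectral norm. *)

theory Defs
  imports "Jordan_Normal_Form.Schur_Decomposition"
begin

definition normal_mat :: "complex mat \<Rightarrow> bool" where
  "normal_mat A \<longleftrightarrow> A * mat_adjoint A = mat_adjoint A * A"

definition eigvals_list :: "complex mat \<Rightarrow> complex list" where
  "eigvals_list A = (SOME es. length es = dim_row A \<and>
      char_poly A = (\<Prod>e\<leftarrow>es. [:- e, 1:]))"

definition sing_vals_list :: "complex mat \<Rightarrow> real list" where
  "sing_vals_list M = rev (sort (map (\<lambda>e. sqrt (Re e)) (eigvals_list (mat_adjoint M * M))))"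

definition sigma :: "nat \<Rightarrow> complex mat \<Rightarrow> real" where
  "sigma j M = (if 1 \<le> j \<and> j \<le> min (dim_row M) (dim_col M)
                then sing_vals_list M ! (j - 1) else 0)"

definition spec_norm :: "complex mat \<Rightarrow> real" where
  "spec_norm M = sigma 1 M"

end

theory Submission
  imports Defs "HOL-Analysis.L2_Norm"
begin

text \<open>After unitary changes of basis \<open>A\<close> and \<open>B\<close> are diagonal. Split \<open>F\<close> along its singular value
  decomposition into rank-one pieces \<open>F\<^sub>0, F\<^sub>1, \<dots>\<close> and let \<open>X\<^sub>j\<close> solve \<open>A X\<^sub>j - X\<^sub>j B = F\<^sub>j\<close>. One ADI step with
  \<open>s(z) = (z - \<phi>) / (z + \<phi>)\<close> changes \<open>X\<^sub>j\<close> by a matrix of rank one and multiplies the norm of what remains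
  by at most \<open>1 / \<mu>\<^sub>1\<close>. Taking \<open>k - j\<close> steps on \<open>X\<^sub>j\<close> for \<open>j < k\<close> costs rank \<open>k + (k - 1) + \<dots> + 1 = t\<close>, and all of the
  \<open>k + 1\<close> error terms, the tail of \<open>F\<close> included, have the size \<open>\<mu>\<^sub>1\<^sup>-\<^sup>k\<close>. The norms of
  \<open>X\<close> and \<open>F\<close> are compared by \<open>\<parallel>F\<parallel> \<le> 2 (z0 + \<eta>) \<parallel>X\<parallel>\<close> and \<open>\<parallel>X\<^sub>j\<parallel> \<le> \<parallel>F\<^sub>j\<parallel> / (2 (z0 - \<eta>))\<close>. Finally
  \<open>k + 1 \<le> 3/2 sqrt t + 1\<close>.\<close>

subsection \<open>Unitary matrices and the Euclidean norm\<close>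

lemma mat_adjoint_eq:
  fixes A :: "complex mat"
  shows "mat_adjoint A = mat (dim_col A) (dim_row A) (\<lambda>(i, j). cnj (A $$ (j, i)))"
  by (rule eq_matI) (auto simp: mat_adjoint_def mat_of_rows_def)

lemma mat_adjoint_carrier [simp, intro]:
  "A \<in> carrier_mat m n \<Longrightarrow> mat_adjoint (A :: complex mat) \<in> carrier_mat n m"
  by (simp add: mat_adjoint_eq)

lemma mat_adjoint_dims [simp]:
  "dim_row (mat_adjoint (A :: complex mat)) = dim_col A"
  "dim_col (mat_adjoint (A :: complex mat)) = dim_row A"
  by (simp_all add: mat_adjoint_eq)

lemma mat_adjoint_index [simp]:
  "i < dim_col A \<Longrightarrow> j < dim_row A \<Longrightarrow> mat_adjoint (A :: complex mat) $$ (i, j) = cnj (A $$ (j, i))"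
  by (simp add: mat_adjoint_eq)

lemma mat_adjoint_adjoint [simp]: "mat_adjoint (mat_adjoint A) = (A :: complex mat)"
  by (rule eq_matI) auto

lemma mat_adjoint_mult:
  assumes "A \<in> carrier_mat l m" "B \<in> carrier_mat m n"
  shows "mat_adjoint (A * B) = mat_adjoint B * mat_adjoint (A :: complex mat)"
  using assms by (intro eq_matI) (auto simp: scalar_prod_def mult.commute)

text \<open>Dimension equations in place of carrier premises can be discharged by simplification
  alone, so \<open>mat_simps\<close> brings products of matrices and adjoints to a right-nested
  form.\<close>

lemma assoc_mult_mat_dims:
  "dim_col A = dim_row B \<Longrightarrow> dim_col B = dim_row C \<Longrightarrow> A * B * C = A * (B * (C :: complex mat))"
  by (rule assoc_mult_mat[of A "dim_row A" "dim_row B" B "dim_col B" C "dim_col C"]) auto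

lemma mat_adjoint_mult_dims:
  "dim_col A = dim_row B \<Longrightarrow> mat_adjoint (A * B) = mat_adjoint B * mat_adjoint (A :: complex mat)"
  by (rule mat_adjoint_mult[of A "dim_row A" "dim_row B" B "dim_col B"]) auto

lemmas mat_simps = assoc_mult_mat_dims mat_adjoint_mult_dims

lemma mat_adjoint_one [simp]: "mat_adjoint (1\<^sub>m n :: complex mat) = 1\<^sub>m n"
  by (rule eq_matI) auto

definition unitary_mat :: "nat \<Rightarrow> complex mat \<Rightarrow> bool" where
  "unitary_mat n U \<longleftrightarrow> U \<in> carrier_mat n n \<and> mat_adjoint U * U = 1\<^sub>m n"

text \<open>A left inverse of a square matrix is also a right inverse, which is why the definition
  asks for one product only.\<close>

lemma unitary_matD:
  assumes "unitary_mat n U"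
  shows "U \<in> carrier_mat n n" "mat_adjoint U * U = 1\<^sub>m n" "U * mat_adjoint U = 1\<^sub>m n"
    and "mat_adjoint U \<in> carrier_mat n n"
  using assms mat_mult_left_right_inverse[of "mat_adjoint U" n U]
  by (auto simp: unitary_mat_def)

lemma unitary_mat_adjoint: "unitary_mat n U \<Longrightarrow> unitary_mat n (mat_adjoint U)"
  unfolding unitary_mat_def[of n "mat_adjoint U"] mat_adjoint_adjoint
  by (intro conjI unitary_matD(3,4))

lemma unitary_cancel_left:
  assumes "unitary_mat n U" "dim_row M = n"
  shows "U * (mat_adjoint U * M) = M" "mat_adjoint U * (U * M) = M"
  using unitary_matD[OF assms(1)] assms(2)
  by (simp_all flip: assoc_mult_mat_dims)

lemma unitary_mat_mult:
  assumes U: "unitary_mat n U" and V: "unitary_mat n V"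
  shows "unitary_mat n (U * V)"
proof -
  note u = unitary_matD[OF U] and v = unitary_matD[OF V]
  have dims [simp]: "dim_row U = n" "dim_col U = n" "dim_row V = n" "dim_col V = n"
    using u(1) v(1) by auto
  have "mat_adjoint (U * V) * (U * V) = 1\<^sub>m n"
    by (simp add: mat_simps unitary_cancel_left[OF U] v(2))
  then show ?thesis
    using u(1) v(1) by (simp add: unitary_mat_def)
qed

lemma normal_mat_unitary_conj:
  assumes A: "A \<in> carrier_mat n n" and nA: "normal_mat A" and U: "unitary_mat n U"
  shows "normal_mat (mat_adjoint U * A * U)"
proof -
  note u = unitary_matD[OF U]
  have dims [simp]: "dim_row A = n" "dim_col A = n" "dim_row U = n" "dim_col U = n"
    using A u(1) by auto
  have "A * (mat_adjoint A * U) = mat_adjoint A * (A * U)"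
    using nA unfolding normal_mat_def by (simp flip: assoc_mult_mat_dims)
  then show ?thesis
    by (simp only: normal_mat_def mat_simps unitary_cancel_left[OF U] dims mat_adjoint_dims index_mult_mat mat_adjoint_adjoint)
qed

section \<open>The Euclidean norm of complex vectors\<close>

definition vnorm :: "complex vec \<Rightarrow> real" where
  "vnorm v = L2_set (\<lambda>i. cmod (v $ i)) {..<dim_vec v}"

lemma vnorm_nonneg [simp]: "0 \<le> vnorm v"
  by (simp add: vnorm_def L2_set_nonneg)

lemma vnorm_sq: "(vnorm v)\<^sup>2 = (\<Sum>i<dim_vec v. (cmod (v $ i))\<^sup>2)"
  by (simp add: vnorm_def L2_set_def sum_nonneg)

lemma cscalar_self: "v \<bullet>c v = complex_of_real ((vnorm v)\<^sup>2)"
  unfolding vnorm_sq scalar_prod_def of_real_sum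
  by (auto simp: complex_norm_square lessThan_atLeast0 simp del: of_real_power intro!: sum.cong)

lemma vnorm_zero_vec [simp]: "vnorm (0\<^sub>v n) = 0"
  using vnorm_sq[of "0\<^sub>v n"] by simp

lemma vnorm_pos: 
  assumes "v \<in> carrier_vec n" "v \<noteq> 0\<^sub>v n"
  shows "0 < vnorm v"
proof -
  have "v \<bullet>c v \<noteq> 0"
    using assms conjugate_square_eq_0_vec[of v n] by simp
  then have "vnorm v \<noteq> 0"
    unfolding cscalar_self by auto
  then show ?thesis
    using vnorm_nonneg[of v] by linarith
qed

lemma vnorm_smult: "vnorm (c \<cdot>\<^sub>v v) = cmod c * vnorm v"
  unfolding vnorm_def L2_set_right_distrib[OF norm_ge_zero] by (simp add: L2_set_def norm_mult)

lemma vnorm_add: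
  assumes "v \<in> carrier_vec n" "w \<in> carrier_vec n"
  shows "vnorm (v + w) \<le> vnorm v + vnorm w"
proof -
  have "vnorm (v + w) \<le> L2_set (\<lambda>i. cmod (v $ i) + cmod (w $ i)) {..<n}"
    unfolding vnorm_def using assms by (auto intro!: L2_set_mono norm_triangle_ineq)
  also have "\<dots> \<le> vnorm v + vnorm w"
    unfolding vnorm_def using assms L2_set_triangle_ineq by auto
  finally show ?thesis .
qed

lemma cscalar_adjoint:
  fixes A :: "complex mat"
  assumes "A \<in> carrier_mat m n" "v \<in> carrier_vec n" "w \<in> carrier_vec m"
  shows "(A *\<^sub>v v) \<bullet>c w = v \<bullet>c (mat_adjoint A *\<^sub>v w)"
proof -
  have "(A *\<^sub>v v) \<bullet>c w = (\<Sum>i<m. \<Sum>j<n. A $$ (i, j) * v $ j * cnj (w $ i))"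
    using assms by (auto simp: scalar_prod_def lessThan_atLeast0 sum_distrib_right intro!: sum.cong)
  also have "\<dots> = (\<Sum>j<n. \<Sum>i<m. A $$ (i, j) * v $ j * cnj (w $ i))"
    by (rule sum.swap)
  also have "\<dots> = v \<bullet>c (mat_adjoint A *\<^sub>v w)"
    using assms by (auto simp: scalar_prod_def lessThan_atLeast0 sum_distrib_left intro!: sum.cong)
  finally show ?thesis .
qed

lemma vnorm_unitary:
  assumes U: "unitary_mat n U" and v: "v \<in> carrier_vec n"
  shows "vnorm (U *\<^sub>v v) = vnorm v"
proof -
  note u = unitary_matD[OF U]
  have "(U *\<^sub>v v) \<bullet>c (U *\<^sub>v v) = v \<bullet>c ((mat_adjoint U * U) *\<^sub>v v)"
    using u(1,4) v by (simp add: cscalar_adjoint[of U n n] assoc_mult_mat_vec[of _ n n _ n])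
  also have "\<dots> = v \<bullet>c v"
    using u(2) v by simp
  finally have "(vnorm (U *\<^sub>v v))\<^sup>2 = (vnorm v)\<^sup>2"
    unfolding cscalar_self of_real_eq_iff .
  then show ?thesis by simp
qed

text \<open>Complete \<open>v\<close> to a basis, orthogonalize it by Gram-Schmidt, which keeps the
  first vector, and normalize. The factor \<open>c\<close> is then
  \<open>1 / vnorm v\<close>.\<close>

lemma ex_unitary_first_col:
  assumes v: "v \<in> carrier_vec n" and v0: "v \<noteq> 0\<^sub>v n"
  shows "\<exists>W c. unitary_mat n W \<and> col W 0 = c \<cdot>\<^sub>v v"
proof -
  interpret cof_vec_space n "TYPE(complex)" .
  define b where "b = basis_completion v"
  define ws where "ws = gram_schmidt n b"
  note bc = basis_completion[OF v v0, folded b_def]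
  note gs = gram_schmidt_result[OF bc(2,4,5) ws_def]
  have n0: "0 < n" 
    using v v0 by (cases n) auto
  obtain vs where bv: "b = v # vs" 
    using bc(6,7) n0 by (cases b) auto
  have len: "length ws = n" 
    using gs(4) bc(6) by simp
  have "hd ws = v" 
    unfolding ws_def bv by (rule gram_schmidt_hd[OF v])
  then have w0: "ws ! 0 = v" 
    using len n0 by (cases ws) auto
  have wc: "ws ! i \<in> carrier_vec n" if "i < n" for i
    using that gs(3) len by (meson nth_mem subsetD)
  have wpos: "vnorm (ws ! i) > 0" if "i < n" for i
  proof -
    have "ws ! i \<bullet>c ws ! i \<noteq> 0"
      using gs(2) that len by (simp add: corthogonal_def)
    then have "vnorm (ws ! i) \<noteq> 0" 
      unfolding cscalar_self by auto
    then show ?thesis using vnorm_nonneg[of "ws ! i"] by linarith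
  qed
  define d where "d i = complex_of_real (1 / vnorm (ws ! i))" for i
  define W where "W = mat_of_cols n (map (\<lambda>i. d i \<cdot>\<^sub>v ws ! i) [0..<n])"
  have W: "W \<in> carrier_mat n n" 
    by (simp add: W_def mat_of_cols_def)
  have colW: "col W i = d i \<cdot>\<^sub>v ws ! i" if "i < n" for i
    using that wc by (simp add: W_def)
  have "mat_adjoint W * W = 1\<^sub>m n"
  proof (rule eq_matI)
    fix i j assume "i < dim_row (1\<^sub>m n :: complex mat)" "j < dim_col (1\<^sub>m n :: complex mat)"
    then have ij: "i < n" "j < n" by auto
    have "(mat_adjoint W * W) $$ (i, j) = col W j \<bullet>c col W i"
      using W ij by (auto simp: scalar_prod_def mult.commute)
    also have "\<dots> = d j * (cnj (d i) * (ws ! j \<bullet>c ws ! i))"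
      using wc[OF ij(1)] wc[OF ij(2)] by (simp add: colW ij conjugate_smult_vec)
    also have "\<dots> = (if i = j then 1 else 0)"
    proof (cases "i = j")
      case True
      then show ?thesis
        using wpos[OF ij(1)] unfolding True cscalar_self d_def
        by (simp add: power2_eq_square)
    next
      case False
      then have "ws ! j \<bullet>c ws ! i = 0"
        using gs(2) ij len by (auto simp: corthogonal_def)
      then show ?thesis using False by simp
    qed
    finally show "(mat_adjoint W * W) $$ (i, j) = 1\<^sub>m n $$ (i, j)"
      using ij by simp
  qed (use W in auto)
  then have "unitary_mat n W" 
    using W by (simp add: unitary_mat_def)
  then show ?thesis
    using colW[OF n0] w0 by auto
qed

subsection \<open>Unitary diagonalization and singular values\<close>

lemma mult_block_diag:
  fixes A1 :: "complex mat"
  assumes "A1 \<in> carrier_mat 1 1" "A2 \<in> carrier_mat k k" "B1 \<in> carrier_mat 1 1" "B2 \<in> carrier_mat k k"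
  shows "four_block_mat A1 (0\<^sub>m 1 k) (0\<^sub>m k 1) A2 * four_block_mat B1 (0\<^sub>m 1 k) (0\<^sub>m k 1) B2
    = four_block_mat (A1 * B1) (0\<^sub>m 1 k) (0\<^sub>m k 1) (A2 * B2)"
  using assms by (subst mult_four_block_mat[of _ 1 1 _ k _ k _ _ 1 _ k]) auto

lemma adjoint_block_diag:
  fixes A1 :: "complex mat"
  assumes "A1 \<in> carrier_mat 1 1" "A2 \<in> carrier_mat k k"
  shows "mat_adjoint (four_block_mat A1 (0\<^sub>m 1 k) (0\<^sub>m k 1) A2)
    = four_block_mat (mat_adjoint A1) (0\<^sub>m 1 k) (0\<^sub>m k 1) (mat_adjoint A2)"
  using assms by (intro eq_matI) auto

lemma normal_mat_entries:
  assumes A: "A \<in> carrier_mat n n" and nA: "normal_mat A" and "i < n" "j < n"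
  shows "(\<Sum>k<n. A $$ (i, k) * cnj (A $$ (j, k))) = (\<Sum>k<n. cnj (A $$ (k, i)) * A $$ (k, j))"
proof -
  have "(A * mat_adjoint A) $$ (i, j) = (mat_adjoint A * A) $$ (i, j)"
    using nA by (simp add: normal_mat_def)
  then show ?thesis
    using assms by (auto simp: scalar_prod_def lessThan_atLeast0)
qed

text \<open>If the first column of a normal matrix vanishes below the diagonal, comparing the \<open>(0, 0)\<close>
  entries of \<open>A A*\<close> and \<open>A* A\<close> shows that the first row vanishes beyond the diagonal.\<close>

lemma normal_mat_deflate:
  assumes A: "A \<in> carrier_mat (Suc k) (Suc k)" and nA: "normal_mat A"
    and col0: "\<And>i. i < k \<Longrightarrow> A $$ (Suc i, 0) = 0"
  defines "A3 \<equiv> mat k k (\<lambda>(i, j). A $$ (Suc i, Suc j))"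
  shows "A = four_block_mat (mat 1 1 (\<lambda>_. A $$ (0, 0))) (0\<^sub>m 1 k) (0\<^sub>m k 1) A3" "normal_mat A3"
proof -
  have "(\<Sum>j<Suc k. (cmod (A $$ (0, j)))\<^sup>2) = (cmod (A $$ (0, 0)))\<^sup>2"
  proof -
    have "complex_of_real (\<Sum>j<Suc k. (cmod (A $$ (0, j)))\<^sup>2) = (\<Sum>j<Suc k. A $$ (0, j) * cnj (A $$ (0, j)))"
      by (simp only: of_real_sum complex_norm_square)
    also have "\<dots> = (\<Sum>j<Suc k. cnj (A $$ (j, 0)) * A $$ (j, 0))"
      by (rule normal_mat_entries[OF A nA]) auto
    also have "\<dots> = complex_of_real ((cmod (A $$ (0, 0)))\<^sup>2)"
      unfolding sum.lessThan_Suc_shift using col0 by (simp only: complex_norm_square) (simp add: mult.commute)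
    finally show ?thesis unfolding of_real_eq_iff .
  qed
  then have "(\<Sum>j<k. (cmod (A $$ (0, Suc j)))\<^sup>2) = 0"
    unfolding sum.lessThan_Suc_shift by simp
  then have row0: "A $$ (0, Suc j) = 0" if "j < k" for j
    using that by (subst (asm) sum_nonneg_eq_0_iff) auto
  show "A = four_block_mat (mat 1 1 (\<lambda>_. A $$ (0, 0))) (0\<^sub>m 1 k) (0\<^sub>m k 1) A3"
  proof (rule eq_matI, goal_cases)
    case (1 i j)
    then show ?case using row0 col0 by (cases i; cases j) (auto simp: A3_def)
  qed (use A in \<open>auto simp: A3_def\<close>)
  \<comment> \<open>In the entries at \<open>(Suc i, Suc j)\<close> of the two products for
    \<open>A\<close>, the summand with index 0 vanishes by \<open>col0\<close> and
    \<open>row0\<close>; what remains are the entries for \<open>A3\<close>.\<close>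
  show "normal_mat A3"
    unfolding normal_mat_def
  proof (rule eq_matI, goal_cases)
    case (1 i j)
    then have ij: "i < k" "j < k" by (auto simp: A3_def)
    have "(\<Sum>l<k. A $$ (Suc i, Suc l) * cnj (A $$ (Suc j, Suc l)))
        = (\<Sum>l<k. cnj (A $$ (Suc l, Suc i)) * A $$ (Suc l, Suc j))"
      using normal_mat_entries[OF A nA, of "Suc i" "Suc j"] ij col0 row0
      unfolding sum.lessThan_Suc_shift by simp
    then show ?case
      using ij by (auto simp: A3_def scalar_prod_def lessThan_atLeast0)
  qed (auto simp: A3_def)
qed

text \<open>Spectral theorem, by induction on the list of eigenvalues: a unitary matrix whose first
  column is an eigenvector splits off a 1 by 1 block, and the remaining block is again normal. The
  order of \<open>es\<close> is free, so that the diagonal can later be sorted.\<close>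

lemma normal_mat_unitary_diag:
  assumes "A \<in> carrier_mat n n" "normal_mat A" "char_poly A = (\<Prod>e\<leftarrow>es. [:- e, 1:])"
  shows "\<exists>U. unitary_mat n U \<and> mat_adjoint U * A * U = mat_diag n (\<lambda>i. es ! i)"
  using assms
proof (induction es arbitrary: n A)
  case Nil
  then have "n = 0" 
    using degree_monic_char_poly[of A n] by simp
  then show ?case
    using Nil by (intro exI[of _ "1\<^sub>m 0"]) (auto simp: unitary_mat_def mat_diag_def intro!: eq_matI)
next
  case (Cons e es)
  have A: "A \<in> carrier_mat n n" by fact
  have ev: "eigenvalue A e"
    unfolding eigenvalue_root_char_poly[OF A] Cons.prems(3) by simp
  then obtain v where v: "v \<in> carrier_vec n" "v \<noteq> 0\<^sub>v n" "A *\<^sub>v v = e \<cdot>\<^sub>v v"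
    using A unfolding eigenvalue_def eigenvector_def by auto
  then obtain k where n: "n = Suc k"
    by (cases n) auto
  obtain W c where W: "unitary_mat n W" and W0: "col W 0 = c \<cdot>\<^sub>v v"
    using ex_unitary_first_col[OF v(1,2)] by blast
  note w = unitary_matD[OF W]
  define A' where "A' = mat_adjoint W * A * W"
  have A': "A' \<in> carrier_mat n n" and nA': "normal_mat A'"
    unfolding A'_def using A w(1,4) Cons.prems(2) by (auto intro: normal_mat_unitary_conj[OF _ _ W])
  \<comment> \<open>\<open>A\<close> maps the first column of \<open>W\<close> to \<open>e\<close>
    times itself, and the adjoint of \<open>W\<close> sends that column to the first unit
    vector.\<close>
  have "col A' 0 = e \<cdot>\<^sub>v unit_vec n 0"
  proof -
    have "col A' 0 = mat_adjoint W *\<^sub>v (A *\<^sub>v col W 0)"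
    proof -
      have "col A' 0 = (mat_adjoint W * A) *\<^sub>v col W 0"
        unfolding A'_def by (rule col_mult2[of _ n n _ n]) (use A w(1,4) n in auto)
      also have "\<dots> = mat_adjoint W *\<^sub>v (A *\<^sub>v col W 0)"
        by (rule assoc_mult_mat_vec[of _ n n _ n]) (use A w(1,4) n in \<open>auto intro: col_carrier_vec\<close>)
      finally show ?thesis .
    qed
    also have "A *\<^sub>v col W 0 = e \<cdot>\<^sub>v col W 0"
      unfolding W0 using A v by (simp add: mult_mat_vec[of _ n n] smult_smult_assoc mult.commute)
    also have "mat_adjoint W *\<^sub>v \<dots> = e \<cdot>\<^sub>v col (mat_adjoint W * W) 0"
      using w(1,4) n col_mult2[OF w(4,1), of 0] mult_mat_vec[OF w(4), of "col W 0" e]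
      by (auto simp: carrier_vecI)
    also have "col (mat_adjoint W * W) 0 = unit_vec n 0"
      unfolding w(2) using n by simp
    finally show ?thesis .
  qed
  then have A'0: "A' $$ (i, 0) = (if i = 0 then e else 0)" if "i < n" for i
  proof -
    have "A' $$ (i, 0) = col A' 0 $ i" using that A' n by simp
    also have "\<dots> = (if i = 0 then e else 0)"
      unfolding \<open>col A' 0 = _\<close> using that by simp
    finally show ?thesis .
  qed
  define A3 where "A3 = mat k k (\<lambda>(i, j). A' $$ (Suc i, Suc j))"
  let ?E = "mat 1 1 (\<lambda>_. e) :: complex mat"
  have E: "?E \<in> carrier_mat 1 1" by simp
  have A3: "A3 \<in> carrier_mat k k" by (simp add: A3_def)
  have block: "A' = four_block_mat ?E (0\<^sub>m 1 k) (0\<^sub>m k 1) A3" and nA3: "normal_mat A3"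
    using normal_mat_deflate[of A' k] A' nA' A'0 unfolding n A3_def by auto
  have "similar_mat A' A"
    unfolding A'_def similar_mat_def
    using A w by (intro exI[of _ "mat_adjoint W"] exI[of _ W] similar_mat_witI[of _ _ n]) auto
  then have "char_poly A' = [:- e, 1:] * (\<Prod>e\<leftarrow>es. [:- e, 1:])"
    using char_poly_similar[of A' A] Cons.prems(3) by simp
  moreover have "char_poly A' = char_poly ?E * char_poly A3"
    unfolding block by (rule char_poly_four_block_zeros_col[OF _ _ A3]) auto
  moreover have "char_poly ?E = [:- e, 1:]"
    by (simp add: char_poly_defs det_def sign_def)
  \<comment> \<open>Similarity preserves the characteristic polynomial, so the factor of the 1 by 1
    block cancels and the induction hypothesis applies to \<open>A3\<close>.\<close>
  ultimately have "char_poly A3 = (\<Prod>e\<leftarrow>es. [:- e, 1:])"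
    by (metis mult_cancel_left pCons_eq_0_iff zero_neq_one)
  from Cons.IH[OF A3 nA3 this] obtain P where P: "unitary_mat k P"
    and PA: "mat_adjoint P * A3 * P = mat_diag k (\<lambda>i. es ! i)" by blast
  note p = unitary_matD[OF P]
  \<comment> \<open>\<open>Q\<close> lets \<open>P\<close> act on the lower block and fixes the
    first coordinate; \<open>W * Q\<close> then diagonalizes \<open>A\<close>.\<close>
  define Q where "Q = four_block_mat (1\<^sub>m 1) (0\<^sub>m 1 k) (0\<^sub>m k 1) P"
  have Q: "unitary_mat n Q"
    unfolding unitary_mat_def
  proof
    show "Q \<in> carrier_mat n n"
      unfolding Q_def n carrier_mat_def using p(1) by auto
    have "mat_adjoint Q * Q = four_block_mat (1\<^sub>m 1) (0\<^sub>m 1 k) (0\<^sub>m k 1) (1\<^sub>m k)"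
      unfolding Q_def adjoint_block_diag[OF one_carrier_mat p(1)] mat_adjoint_one
        mult_block_diag[OF one_carrier_mat p(4) one_carrier_mat p(1)] p(2)
      by (simp only: left_mult_one_mat[OF one_carrier_mat])
    also have "\<dots> = 1\<^sub>m n"
      unfolding n by (rule eq_matI) auto
    finally show "mat_adjoint Q * Q = 1\<^sub>m n" .
  qed
  note q = unitary_matD[OF Q]
  have "mat_adjoint (W * Q) * A * (W * Q) = mat_adjoint Q * A' * Q"
    using A w(1) q(1) by (simp add: A'_def mat_simps)
  also have "\<dots> = four_block_mat ?E (0\<^sub>m 1 k) (0\<^sub>m k 1) (mat_diag k (\<lambda>i. es ! i))"
    unfolding block Q_def adjoint_block_diag[OF one_carrier_mat p(1)] mat_adjoint_one
      mult_block_diag[OF one_carrier_mat p(4) E A3]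
      mult_block_diag[OF mult_carrier_mat[OF one_carrier_mat E] mult_carrier_mat[OF p(4) A3] one_carrier_mat p(1)] PA
    by (simp only: left_mult_one_mat[OF E] right_mult_one_mat[OF E])
  also have "\<dots> = mat_diag n (\<lambda>i. (e # es) ! i)"
    by (rule eq_matI) (auto simp: n mat_diag_def)
  finally show ?case
    using unitary_mat_mult[OF W Q] by blast
qed

lemma mat_diag_mult_vec:
  fixes d :: "nat \<Rightarrow> complex"
  assumes "v \<in> carrier_vec n"
  shows "mat_diag n d *\<^sub>v v = vec n (\<lambda>i. d i * v $ i)"
  using assms unfolding mat_diag_def
  by (intro eq_vecI) (auto simp: scalar_prod_def lessThan_atLeast0[symmetric] if_distrib[of "\<lambda>z. z * _"] sum.If_cases cong: if_cong)

section \<open>Eigenvalue lists and the singular value decomposition\<close>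

lemma eigvals_list:
  assumes "A \<in> carrier_mat n n"
  shows "length (eigvals_list A) = n" "char_poly A = (\<Prod>e\<leftarrow>eigvals_list A. [:- e, 1:])"
proof -
  have "\<exists>es. length es = dim_row A \<and> char_poly A = (\<Prod>e\<leftarrow>es. [:- e, 1:])"
    using char_poly_factorized[OF assms] assms by auto
  from someI_ex[OF this] show "length (eigvals_list A) = n" "char_poly A = (\<Prod>e\<leftarrow>eigvals_list A. [:- e, 1:])"
    using assms unfolding eigvals_list_def by auto
qed

lemma eigvals_list_eigenvalue:
  assumes A: "A \<in> carrier_mat n n" and e: "e \<in> set (eigvals_list A)"
  shows "eigenvalue A e"
  unfolding eigenvalue_root_char_poly[OF A] eigvals_list(2)[OF A] poly_prod_list
  using e by (auto simp: prod_list_zero_iff intro!: image_eqI[of _ _ e])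

lemma sigma_svd:
  assumes M: "M \<in> carrier_mat m n" and nm: "n \<le> m"
  shows "\<exists>V. unitary_mat n V \<and>
    (\<forall>w\<in>carrier_vec n. (vnorm (M *\<^sub>v (V *\<^sub>v w)))\<^sup>2 = (\<Sum>i<n. (sigma (Suc i) M)\<^sup>2 * (cmod (w $ i))\<^sup>2))"
    and "\<And>i. i < n \<Longrightarrow> 0 \<le> sigma (Suc i) M"
    and "\<And>i j. i \<le> j \<Longrightarrow> j < n \<Longrightarrow> sigma (Suc j) M \<le> sigma (Suc i) M"
proof -
  define G where "G = mat_adjoint M * M"
  define f where "f e = sqrt (Re e)" for e
  \<comment> \<open>The eigenvalues are sorted before diagonalizing, so that the \<open>i\<close>th
    diagonal entry belongs to \<open>sigma (Suc i) M\<close>.\<close>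
  define es where "es = rev (sort_key f (eigvals_list G))"
  have [simp]: "dim_row M = m" "dim_col M = n" using M by auto
  have G: "G \<in> carrier_mat n n" unfolding G_def using M by auto
  have nG: "normal_mat G" unfolding normal_mat_def G_def by (simp add: mat_simps)
  have "mset es = mset (eigvals_list G)"
    by (simp add: es_def)
  then have cp: "char_poly G = (\<Prod>e\<leftarrow>es. [:- e, 1:])"
    unfolding eigvals_list(2)[OF G] by (metis mset_map prod_mset_prod_list)
  have len: "length es = n"
    by (simp add: es_def eigvals_list(1)[OF G])
  have "sort (map f (eigvals_list G)) = map f (sort_key f (eigvals_list G))"
    by (rule properties_for_sort) auto
  then have svl: "sing_vals_list M = map f es"
    unfolding sing_vals_list_def G_def[symmetric] f_def[abs_def, symmetric] es_def by (simp add: rev_map f_def)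
  have sig: "sigma (Suc i) M = f (es ! i)" if "i < n" for i
    using that nm len by (simp add: sigma_def svl)
  have sorted: "sorted (rev (map f es))"
    by (simp add: es_def rev_map)
  obtain V where V: "unitary_mat n V" and VG: "mat_adjoint V * G * V = mat_diag n (\<lambda>i. es ! i)"
    using normal_mat_unitary_diag[OF G nG cp] by blast
  note v = unitary_matD[OF V]
  \<comment> \<open>The conjugate comes from the second argument of the scalar product; it
    disappears once the eigenvalues are known to be real.\<close>
  have eq: "complex_of_real ((vnorm (M *\<^sub>v (V *\<^sub>v w)))\<^sup>2) = (\<Sum>i<n. cnj (es ! i) * complex_of_real ((cmod (w $ i))\<^sup>2))"
    if w: "w \<in> carrier_vec n" for w
  proof -
    have "complex_of_real ((vnorm (M *\<^sub>v (V *\<^sub>v w)))\<^sup>2) = ((M * V) *\<^sub>v w) \<bullet>c ((M * V) *\<^sub>v w)"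
      using M v(1) w by (simp add: cscalar_self)
    also have "\<dots> = w \<bullet>c (mat_adjoint (M * V) *\<^sub>v ((M * V) *\<^sub>v w))"
      by (rule cscalar_adjoint[of _ m n]) (use M v(1) w in auto)
    also have "mat_adjoint (M * V) *\<^sub>v ((M * V) *\<^sub>v w) = (mat_adjoint (M * V) * (M * V)) *\<^sub>v w"
      by (rule assoc_mult_mat_vec[symmetric, of _ n m _ n]) (use M v(1) w in auto)
    also have "mat_adjoint (M * V) * (M * V) = mat_diag n (\<lambda>i. es ! i)"
      using v(1) by (simp add: VG[symmetric] mat_simps G_def)
    also have "w \<bullet>c (mat_diag n (\<lambda>i. es ! i) *\<^sub>v w) = (\<Sum>i<n. cnj (es ! i) * (w $ i * cnj (w $ i)))"
      using w unfolding mat_diag_mult_vec[OF w]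
      by (auto simp: scalar_prod_def lessThan_atLeast0 intro!: sum.cong)
    finally show ?thesis
      by (simp only: complex_norm_square)
  qed
  \<comment> \<open>Testing with the \<open>i\<close>th unit vector shows that the eigenvalue is a
    squared norm, hence real and nonnegative, so \<open>sqrt (Re e)\<close> squares back to
    it.\<close>
  have es: "es ! i = complex_of_real ((sigma (Suc i) M)\<^sup>2) \<and> 0 \<le> f (es ! i)" if i: "i < n" for i
  proof -
    have "complex_of_real ((vnorm (M *\<^sub>v (V *\<^sub>v unit_vec n i)))\<^sup>2) 
        = (\<Sum>j<n. cnj (es ! j) * complex_of_real ((cmod (unit_vec n i $ j))\<^sup>2))"
      by (rule eq) simp
    also have "\<dots> = (\<Sum>j<n. if j = i then cnj (es ! i) else 0)"
      by (rule sum.cong) (auto simp: i)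
    also have "\<dots> = cnj (es ! i)"
      using i by simp
    finally have "complex_of_real ((vnorm (M *\<^sub>v (V *\<^sub>v unit_vec n i)))\<^sup>2) = es ! i"
      by (metis complex_cnj_cnj complex_cnj_complex_of_real)
    then obtain x where "es ! i = complex_of_real (x\<^sup>2)" by metis
    then show ?thesis
      by (simp add: sig[OF i] f_def)
  qed
  then show "\<And>i. i < n \<Longrightarrow> 0 \<le> sigma (Suc i) M"
    by (simp add: sig)
  show "sigma (Suc j) M \<le> sigma (Suc i) M" if "i \<le> j" "j < n" for i j
    using sorted that len by (auto simp: sig sorted_rev_iff_nth_mono)
  have "(vnorm (M *\<^sub>v (V *\<^sub>v w)))\<^sup>2 = (\<Sum>i<n. (sigma (Suc i) M)\<^sup>2 * (cmod (w $ i))\<^sup>2)" if w: "w \<in> carrier_vec n" for w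
  proof -
    have "complex_of_real ((vnorm (M *\<^sub>v (V *\<^sub>v w)))\<^sup>2)
        = complex_of_real (\<Sum>i<n. (sigma (Suc i) M)\<^sup>2 * (cmod (w $ i))\<^sup>2)"
      unfolding eq[OF w] of_real_sum of_real_mult
      by (rule sum.cong) (use es in auto)
    then show ?thesis unfolding of_real_eq_iff .
  qed
  with V show "\<exists>V. unitary_mat n V \<and>
    (\<forall>w\<in>carrier_vec n. (vnorm (M *\<^sub>v (V *\<^sub>v w)))\<^sup>2 = (\<Sum>i<n. (sigma (Suc i) M)\<^sup>2 * (cmod (w $ i))\<^sup>2))"
    by blast
qed

subsection \<open>Operator norm and rank\<close>

text \<open>A predicate bounding the operator norm avoids a supremum; \<open>spec_norm_le\<close>
  and \<open>op_bound_spec_norm\<close> identify \<open>spec_norm\<close> as the least such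
  bound.\<close>

definition op_bound :: "complex mat \<Rightarrow> real \<Rightarrow> bool" where
  "op_bound M c \<longleftrightarrow> 0 \<le> c \<and> (\<forall>v\<in>carrier_vec (dim_col M). vnorm (M *\<^sub>v v) \<le> c * vnorm v)"

lemma op_boundD: "op_bound M c \<Longrightarrow> M \<in> carrier_mat m n \<Longrightarrow> v \<in> carrier_vec n \<Longrightarrow> vnorm (M *\<^sub>v v) \<le> c * vnorm v"
  by (auto simp: op_bound_def)

lemma op_bound_nonneg: "op_bound M c \<Longrightarrow> 0 \<le> c"
  by (simp add: op_bound_def)

lemma op_bound_mono: "op_bound M c \<Longrightarrow> c \<le> d \<Longrightarrow> op_bound M d"
  unfolding op_bound_def by (meson mult_right_mono order_trans vnorm_nonneg)

lemma op_bound_add: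
  assumes "op_bound M c" "op_bound N d" "M \<in> carrier_mat m n" "N \<in> carrier_mat m n"
  shows "op_bound (M + N) (c + d)"
  unfolding op_bound_def
proof (intro conjI ballI)
  fix v :: "complex vec" assume "v \<in> carrier_vec (dim_col (M + N))"
  then have v: "v \<in> carrier_vec n" using assms by simp
  have "vnorm ((M + N) *\<^sub>v v) = vnorm (M *\<^sub>v v + N *\<^sub>v v)"
    using assms v by (simp add: add_mult_distrib_mat_vec[of _ m n])
  also have "\<dots> \<le> vnorm (M *\<^sub>v v) + vnorm (N *\<^sub>v v)"
    by (rule vnorm_add[of _ m]) (use assms v in auto)
  also have "\<dots> \<le> c * vnorm v + d * vnorm v"
    by (intro add_mono op_boundD[of _ _ m n]) (use assms v in auto)
  finally show "vnorm ((M + N) *\<^sub>v v) \<le> (c + d) * vnorm v"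
    by (simp add: distrib_right)
qed (use assms in \<open>auto simp: op_bound_def\<close>)

lemma op_bound_mult:
  assumes "op_bound M c" "op_bound N d" "M \<in> carrier_mat l m" "N \<in> carrier_mat m n"
  shows "op_bound (M * N) (c * d)"
  unfolding op_bound_def
proof (intro conjI ballI)
  fix v :: "complex vec" assume "v \<in> carrier_vec (dim_col (M * N))"
  then have v: "v \<in> carrier_vec n" using assms by simp
  have "vnorm ((M * N) *\<^sub>v v) = vnorm (M *\<^sub>v (N *\<^sub>v v))"
    using assms v by (simp add: assoc_mult_mat_vec[of _ l m _ n])
  also have "\<dots> \<le> c * vnorm (N *\<^sub>v v)"
    by (rule op_boundD[of _ _ l m]) (use assms v in auto)
  also have "\<dots> \<le> c * (d * vnorm v)"
    by (intro mult_left_mono op_boundD[of _ _ m n]) (use assms v op_bound_nonneg in auto)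
  finally show "vnorm ((M * N) *\<^sub>v v) \<le> c * d * vnorm v"
    by (simp add: mult.assoc)
qed (use assms in \<open>auto simp: op_bound_def\<close>)

lemma smult_mat_mult_vec:
  assumes "M \<in> carrier_mat m n" "v \<in> carrier_vec n"
  shows "(k \<cdot>\<^sub>m M) *\<^sub>v v = k \<cdot>\<^sub>v (M *\<^sub>v (v :: complex vec))"
  using assms by (intro eq_vecI) (auto simp: scalar_prod_def sum_distrib_left mult.assoc)

lemma op_bound_smult:
  assumes "op_bound M c"
  shows "op_bound (k \<cdot>\<^sub>m M) (cmod k * c)"
  unfolding op_bound_def
proof (intro conjI ballI)
  fix v :: "complex vec" assume "v \<in> carrier_vec (dim_col (k \<cdot>\<^sub>m M))"
  then have v: "v \<in> carrier_vec (dim_col M)" by simp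
  have "vnorm ((k \<cdot>\<^sub>m M) *\<^sub>v v) = cmod k * vnorm (M *\<^sub>v v)"
    using v by (simp add: smult_mat_mult_vec[of _ "dim_row M" "dim_col M"] vnorm_smult)
  also have "\<dots> \<le> cmod k * (c * vnorm v)"
    by (intro mult_left_mono op_boundD[OF assms _ v, of "dim_row M"]) auto
  finally show "vnorm ((k \<cdot>\<^sub>m M) *\<^sub>v v) \<le> cmod k * c * vnorm v"
    by (simp add: mult.assoc)
qed (use assms in \<open>auto simp: op_bound_def\<close>)

lemma op_bound_diff:
  assumes "op_bound M c" "op_bound N d" "M \<in> carrier_mat m n" "N \<in> carrier_mat m n"
  shows "op_bound (M - N) (c + d)"
proof -
  have "M - N = M + (-1) \<cdot>\<^sub>m N"
    using assms by (intro eq_matI) auto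
  then show ?thesis
    using op_bound_add[OF assms(1) op_bound_smult[OF assms(2), of "-1"], of m n] assms(3,4) by simp
qed

lemma op_bound_zero: "op_bound (0\<^sub>m m n) 0"
proof -
  have "0\<^sub>m m n *\<^sub>v v = 0\<^sub>v m" if "v \<in> carrier_vec n" for v :: "complex vec"
    using that by (intro eq_vecI) auto
  then show ?thesis by (simp add: op_bound_def)
qed

lemma op_bound_diag:
  assumes "\<And>i. i < n \<Longrightarrow> cmod (d i) \<le> c" "0 \<le> c"
  shows "op_bound (mat_diag n d) c"
  unfolding op_bound_def
proof (intro conjI ballI)
  fix v :: "complex vec" assume "v \<in> carrier_vec (dim_col (mat_diag n d))"
  then have v: "v \<in> carrier_vec n" by (simp add: mat_diag_def)
  have "(vnorm (mat_diag n d *\<^sub>v v))\<^sup>2 = (\<Sum>i<n. (cmod (d i) * cmod (v $ i))\<^sup>2)"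
    by (simp add: mat_diag_mult_vec[OF v] vnorm_sq norm_mult)
  also have "\<dots> \<le> (\<Sum>i<n. (c * cmod (v $ i))\<^sup>2)"
    using assms by (intro sum_mono power_mono mult_right_mono) auto
  also have "\<dots> = (c * vnorm v)\<^sup>2"
    using v by (simp add: power_mult_distrib vnorm_sq sum_distrib_left)
  finally show "vnorm (mat_diag n d *\<^sub>v v) \<le> c * vnorm v"
    using assms(2) by (simp add: power2_le_iff_abs_le)
qed (use assms in auto)

text \<open>\<open>M\<close> has rank at most \<open>t\<close>, expressed by \<open>t\<close> linear functionals whose common kernel is
  annihilated by \<open>M\<close>.\<close>

definition low_rank :: "nat \<Rightarrow> complex mat \<Rightarrow> bool" where
  "low_rank t M \<longleftrightarrow> (\<exists>qs. length qs = t \<and> set qs \<subseteq> carrier_vec (dim_col M) \<and>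
     (\<forall>v\<in>carrier_vec (dim_col M). (\<forall>q\<in>set qs. q \<bullet> v = 0) \<longrightarrow> M *\<^sub>v v = 0\<^sub>v (dim_row M)))"

lemma low_rank_zero: "low_rank 0 (0\<^sub>m m n)"
  by (auto simp: low_rank_def)

lemma low_rank_add:
  assumes M: "M \<in> carrier_mat m n" and N: "N \<in> carrier_mat m n"
    and "low_rank s M" "low_rank t N"
  shows "low_rank (s + t) (M + N)"
proof -
  obtain ps where ps: "length ps = s" "set ps \<subseteq> carrier_vec n"
    "\<And>v. v \<in> carrier_vec n \<Longrightarrow> \<forall>q\<in>set ps. q \<bullet> v = 0 \<Longrightarrow> M *\<^sub>v v = 0\<^sub>v m"
    using assms unfolding low_rank_def by auto
  obtain qs where qs: "length qs = t" "set qs \<subseteq> carrier_vec n"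
    "\<And>v. v \<in> carrier_vec n \<Longrightarrow> \<forall>q\<in>set qs. q \<bullet> v = 0 \<Longrightarrow> N *\<^sub>v v = 0\<^sub>v m"
    using assms unfolding low_rank_def by auto
  show ?thesis
    unfolding low_rank_def
  proof (intro exI[of _ "ps @ qs"] conjI ballI impI)
    fix v :: "complex vec"
    assume "v \<in> carrier_vec (dim_col (M + N))" "\<forall>q\<in>set (ps @ qs). q \<bullet> v = 0"
    then show "(M + N) *\<^sub>v v = 0\<^sub>v (dim_row (M + N))"
      using M N ps qs by (simp add: add_mult_distrib_mat_vec[of _ m n])
  qed (use N ps qs in auto)
qed

lemma low_rank_mult_left:
  assumes A: "A \<in> carrier_mat l m" and M: "M \<in> carrier_mat m n" and "low_rank t M"
  shows "low_rank t (A * M)"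
proof -
  obtain qs where qs: "length qs = t" "set qs \<subseteq> carrier_vec n"
    "\<And>v. v \<in> carrier_vec n \<Longrightarrow> \<forall>q\<in>set qs. q \<bullet> v = 0 \<Longrightarrow> M *\<^sub>v v = 0\<^sub>v m"
    using assms unfolding low_rank_def by auto
  have "A *\<^sub>v 0\<^sub>v m = 0\<^sub>v l"
    using A by (intro eq_vecI) auto
  then show ?thesis
    unfolding low_rank_def using A M qs
    by (intro exI[of _ qs]) (auto simp: assoc_mult_mat_vec[of _ l m _ n])
qed

text \<open>The functionals are pulled back along \<open>B\<close>: pairing \<open>q\<close> with
  \<open>B v\<close> is pairing the transpose of \<open>B\<close> applied to \<open>q\<close> with
  \<open>v\<close>.\<close>

lemma low_rank_mult_right:
  assumes M: "M \<in> carrier_mat l m" and B: "B \<in> carrier_mat m n" and "low_rank t M"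
  shows "low_rank t (M * B)"
proof -
  obtain qs where qs: "length qs = t" "set qs \<subseteq> carrier_vec m"
    "\<And>v. v \<in> carrier_vec m \<Longrightarrow> \<forall>q\<in>set qs. q \<bullet> v = 0 \<Longrightarrow> M *\<^sub>v v = 0\<^sub>v l"
    using assms unfolding low_rank_def by auto
  show ?thesis
    unfolding low_rank_def
  proof (intro exI[of _ "map (\<lambda>q. transpose_mat B *\<^sub>v q) qs"] conjI ballI impI)
    fix v :: "complex vec"
    assume "v \<in> carrier_vec (dim_col (M * B))"
      and *: "\<forall>q\<in>set (map (\<lambda>q. transpose_mat B *\<^sub>v q) qs). q \<bullet> v = 0"
    then have v: "v \<in> carrier_vec n" using B by simp
    have "q \<bullet> (B *\<^sub>v v) = 0" if "q \<in> set qs" for q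
      using that * qs(2) transpose_vec_mult_scalar[OF B v, of q] by auto
    then show "(M * B) *\<^sub>v v = 0\<^sub>v (dim_row (M * B))"
      using M B v qs(3) by (simp add: assoc_mult_mat_vec[of _ l m _ n])
  qed (use B qs in auto)
qed

lemma low_rank_smult: 
  assumes M: "M \<in> carrier_mat m n" and "low_rank t M"
  shows "low_rank t (k \<cdot>\<^sub>m M)"
proof -
  have "k \<cdot>\<^sub>v 0\<^sub>v m = 0\<^sub>v m" by auto
  then show ?thesis
    using assms unfolding low_rank_def by (auto simp: smult_mat_mult_vec[of _ m n])
qed

text \<open>One half of the Eckart--Young theorem: the span of the first \<open>t + 1\<close> right singular vectors
  meets the kernel of \<open>Y\<close>.\<close>

lemma sigma_le_op_bound:
  assumes M: "M \<in> carrier_mat m n" and Y: "Y \<in> carrier_mat m n" and nm: "n \<le> m" and tn: "t < n"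
    and rk: "low_rank t Y" and bd: "op_bound (M - Y) c"
  shows "sigma (Suc t) M \<le> c"
proof -
  note svd = sigma_svd[OF M nm]
  obtain V where V: "unitary_mat n V" and norm_MV: "\<And>w. w \<in> carrier_vec n \<Longrightarrow>
      (vnorm (M *\<^sub>v (V *\<^sub>v w)))\<^sup>2 = (\<Sum>i<n. (sigma (Suc i) M)\<^sup>2 * (cmod (w $ i))\<^sup>2)"
    using svd(1) by blast
  note v = unitary_matD[OF V]
  obtain qs where qs: "length qs = t" "set qs \<subseteq> carrier_vec n"
    "\<And>v. v \<in> carrier_vec n \<Longrightarrow> \<forall>q\<in>set qs. q \<bullet> v = 0 \<Longrightarrow> Y *\<^sub>v v = 0\<^sub>v m"
    using rk Y unfolding low_rank_def by auto
  \<comment> \<open>The first \<open>t\<close> rows evaluate the functionals on the first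
    \<open>t + 1\<close> right singular vectors. The zero last row makes \<open>H\<close> square and
    singular, so \<open>t\<close> equations in \<open>t + 1\<close> unknowns get a nonzero solution
    by determinants.\<close>
  define H where "H = mat (Suc t) (Suc t) (\<lambda>(i, j). if i < t then qs ! i \<bullet> col V j else 0)"
  have H: "H \<in> carrier_mat (Suc t) (Suc t)" by (simp add: H_def)
  have "transpose_mat H *\<^sub>v unit_vec (Suc t) t = 0\<^sub>v (Suc t)"
    by (intro eq_vecI) (auto simp: H_def)
  then have "det (transpose_mat H) = 0"
    using H by (subst det_0_iff_vec_prod_zero[of _ "Suc t"]) (auto intro!: exI[of _ "unit_vec (Suc t) t"])
  then have "det H = 0"
    using det_transpose[OF H] by simp
  then obtain x where x: "x \<in> carrier_vec (Suc t)" "x \<noteq> 0\<^sub>v (Suc t)" "H *\<^sub>v x = 0\<^sub>v (Suc t)"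
    using det_0_iff_vec_prod_zero[OF H] by blast
  \<comment> \<open>Padding by zeros puts \<open>V w\<close> into the span of the first
    \<open>t + 1\<close> columns of \<open>V\<close>.\<close>
  define w where "w = vec n (\<lambda>i. if i < Suc t then x $ i else 0)"
  have w: "w \<in> carrier_vec n" by (simp add: w_def)
  have "w \<noteq> 0\<^sub>v n"
  proof
    assume *: "w = 0\<^sub>v n"
    have "x $ i = 0" if "i < Suc t" for i
      using arg_cong[OF *, of "\<lambda>u. u $ i"] that tn by (simp add: w_def)
    then have "x = 0\<^sub>v (Suc t)" using x(1) by (intro eq_vecI) auto
    with x(2) show False by simp
  qed
  then have pos: "0 < vnorm w" by (rule vnorm_pos[OF w])
  have "q \<bullet> (V *\<^sub>v w) = 0" if "q \<in> set qs" for q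
  proof -
    obtain i where i: "i < t" "q = qs ! i" using \<open>q \<in> set qs\<close> qs(1) by (auto simp: in_set_conv_nth)
    have q: "q \<in> carrier_vec n" using that qs(2) by auto
    have "q \<bullet> (V *\<^sub>v w) = (\<Sum>l<n. \<Sum>j<n. q $ l * V $$ (l, j) * w $ j)"
      using q v(1) w by (auto simp: scalar_prod_def lessThan_atLeast0 sum_distrib_left mult.assoc intro!: sum.cong)
    also have "\<dots> = (\<Sum>j<n. (q \<bullet> col V j) * w $ j)"
      using q v(1) w by (subst sum.swap) (auto simp: scalar_prod_def lessThan_atLeast0 sum_distrib_right intro!: sum.cong)
    also have "\<dots> = (\<Sum>j<Suc t. (q \<bullet> col V j) * x $ j)"
      by (rule sum.mono_neutral_cong_right) (use tn in \<open>auto simp: w_def\<close>)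
    also have "\<dots> = (H *\<^sub>v x) $ i"
      using i x(1) by (auto simp: H_def scalar_prod_def[of _ x] lessThan_atLeast0 intro!: sum.cong)
    also have "\<dots> = 0" using x(3) i by simp
    finally show ?thesis .
  qed
  then have "Y *\<^sub>v (V *\<^sub>v w) = 0\<^sub>v m"
    using qs(3)[of "V *\<^sub>v w"] v(1) w by auto
  then have "(M - Y) *\<^sub>v (V *\<^sub>v w) = M *\<^sub>v (V *\<^sub>v w)"
    using M Y v(1) w by (subst minus_mult_distrib_mat_vec[of _ m n]) auto
  moreover have "vnorm ((M - Y) *\<^sub>v (V *\<^sub>v w)) \<le> c * vnorm (V *\<^sub>v w)"
    by (rule op_boundD[OF bd, of m n]) (use M Y v(1) w in auto)
  ultimately have le: "vnorm (M *\<^sub>v (V *\<^sub>v w)) \<le> c * vnorm w"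
    by (simp add: vnorm_unitary[OF V w])
  \<comment> \<open>\<open>w\<close> is supported on indices up to \<open>t\<close>, where
    \<open>sigma (Suc i) M\<close> is at least \<open>sigma (Suc t) M\<close>.\<close>
  have "(sigma (Suc t) M * vnorm w)\<^sup>2 = (\<Sum>i<n. (sigma (Suc t) M)\<^sup>2 * (cmod (w $ i))\<^sup>2)"
    using w by (simp add: power_mult_distrib vnorm_sq sum_distrib_left)
  also have "\<dots> \<le> (\<Sum>i<n. (sigma (Suc i) M)\<^sup>2 * (cmod (w $ i))\<^sup>2)"
  proof (rule sum_mono)
    fix i assume "i \<in> {..<n}"
    show "(sigma (Suc t) M)\<^sup>2 * (cmod (w $ i))\<^sup>2 \<le> (sigma (Suc i) M)\<^sup>2 * (cmod (w $ i))\<^sup>2"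
    proof (cases "i \<le> t")
      case True
      then show ?thesis
        using svd(2)[OF tn] svd(3)[of i t] tn by (intro mult_right_mono power_mono) auto
    next
      case False
      then show ?thesis using \<open>i \<in> {..<n}\<close> by (simp add: w_def)
    qed
  qed
  also have "\<dots> = (vnorm (M *\<^sub>v (V *\<^sub>v w)))\<^sup>2"
    by (rule norm_MV[OF w, symmetric])
  also have "\<dots> \<le> (c * vnorm w)\<^sup>2"
    by (intro power_mono le) simp
  finally have "sigma (Suc t) M * vnorm w \<le> c * vnorm w"
    using op_bound_nonneg[OF bd] by (simp add: power2_le_iff_abs_le)
  then show ?thesis using pos by simp
qed

text \<open>The case of rank 0 in \<open>sigma_le_op_bound\<close>.\<close>

lemma spec_norm_le:
  assumes "M \<in> carrier_mat m n" "n \<le> m" "0 < n" "op_bound M c"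
  shows "spec_norm M \<le> c"
proof -
  have "M - 0\<^sub>m m n = M" using assms(1) by (intro eq_matI) auto
  then show ?thesis
    using sigma_le_op_bound[OF assms(1) zero_carrier_mat assms(2,3) low_rank_zero] assms(4)
    by (simp add: spec_norm_def)
qed

text \<open>\<open>P S\<close> is the partial sum of the singular value decomposition of \<open>M\<close> over the indices in \<open>S\<close>.\<close>

lemma svd_sections:
  assumes M: "M \<in> carrier_mat m n" and nm: "n \<le> m"
  obtains P :: "nat set \<Rightarrow> complex mat" where
    "\<And>S. P S \<in> carrier_mat m n" "P {..<n} = M"
    "\<And>S T. S \<inter> T = {} \<Longrightarrow> P (S \<union> T) = P S + P T"
    "\<And>i. i < n \<Longrightarrow> low_rank 1 (P {i})"
    "\<And>S c. (\<And>i. i \<in> S \<Longrightarrow> i < n \<Longrightarrow> sigma (Suc i) M \<le> c) \<Longrightarrow> 0 \<le> c \<Longrightarrow> op_bound (P S) c"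
proof -
  note svd = sigma_svd[OF M nm]
  obtain V where V: "unitary_mat n V" and norm_MV: "\<And>w. w \<in> carrier_vec n \<Longrightarrow>
      (vnorm (M *\<^sub>v (V *\<^sub>v w)))\<^sup>2 = (\<Sum>i<n. (sigma (Suc i) M)\<^sup>2 * (cmod (w $ i))\<^sup>2)"
    using svd(1) by blast
  note v = unitary_matD[OF V]
  define D :: "nat set \<Rightarrow> complex mat" where "D S = mat_diag n (\<lambda>i. if i \<in> S then 1 else 0)" for S
  \<comment> \<open>\<open>P S\<close> is \<open>M\<close> after the orthogonal projection onto the
    span of the columns of \<open>V\<close> with index in \<open>S\<close>.\<close>
  define P where "P S = M * (V * (D S * mat_adjoint V))" for S
  have D: "D S \<in> carrier_mat n n" for S by (simp add: D_def)
  show thesis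
  proof
    show "P S \<in> carrier_mat m n" for S
      unfolding P_def using M v(1,4) D[of S] by auto
    have "D {..<n} = 1\<^sub>m n" by (rule eq_matI) (auto simp: D_def mat_diag_def)
    then show "P {..<n} = M"
      unfolding P_def using M v by simp
    show "P (S \<union> T) = P S + P T" if "S \<inter> T = {}" for S T
    proof -
      have "D (S \<union> T) = D S + D T"
        using that by (intro eq_matI) (auto simp: D_def mat_diag_def)
      then show ?thesis
        unfolding P_def using M v(1,4) D[of S] D[of T]
        by (simp add: add_mult_distrib_mat[of _ n n _ _ n] mult_add_distrib_mat[of _ n n _ n] 
            mult_add_distrib_mat[of _ m n _ n])
    qed
    show "low_rank 1 (P {i})" if "i < n" for i
    proof -
      have "low_rank 1 (D {i})"
        unfolding low_rank_def
      proof (intro exI[of _ "[unit_vec n i]"] conjI ballI impI)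
        fix u :: "complex vec"
        assume "u \<in> carrier_vec (dim_col (D {i}))" "\<forall>q\<in>set [unit_vec n i]. q \<bullet> u = 0"
        then have "u \<in> carrier_vec n" "u $ i = 0"
          using D[of "{i}"] that by auto
        then show "D {i} *\<^sub>v u = 0\<^sub>v (dim_row (D {i}))"
          using D[of "{i}"] unfolding D_def
          by (intro eq_vecI) (auto simp: mat_diag_mult_vec carrier_matD(1)[OF mat_diag_dim])
      qed (use D[of "{i}"] in auto)
      then show ?thesis
        unfolding P_def using M v(1,4) D[of "{i}"]
        by (intro low_rank_mult_left[of _ m n _ n] low_rank_mult_left[of _ n n _ n] low_rank_mult_right[of _ n n _ n]) auto
    qed
    show "op_bound (P S) c" if c: "\<And>i. i \<in> S \<Longrightarrow> i < n \<Longrightarrow> sigma (Suc i) M \<le> c" "0 \<le> c" for S c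
      unfolding op_bound_def
    proof (intro conjI ballI)
      fix u :: "complex vec" assume "u \<in> carrier_vec (dim_col (P S))"
      then have u: "u \<in> carrier_vec n" using v(1) by (simp add: P_def)
      define w where "w = mat_adjoint V *\<^sub>v u"
      have w: "w \<in> carrier_vec n" using v(4) u by (auto simp: w_def)
      have "P S *\<^sub>v u = M *\<^sub>v (V *\<^sub>v (D S *\<^sub>v w))"
        unfolding P_def w_def using M v(1,4) D[of S] u
        by (simp add: assoc_mult_mat_vec[of _ m n _ n] assoc_mult_mat_vec[of _ n n _ n])
      then have "(vnorm (P S *\<^sub>v u))\<^sup>2 = (\<Sum>i<n. (sigma (Suc i) M)\<^sup>2 * (cmod ((D S *\<^sub>v w) $ i))\<^sup>2)"
        using norm_MV[of "D S *\<^sub>v w"] D[of S] w by auto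
      also have "\<dots> \<le> (\<Sum>i<n. c\<^sup>2 * (cmod (w $ i))\<^sup>2)"
      proof (rule sum_mono)
        fix i assume "i \<in> {..<n}"
        then have i: "i < n" by simp
        show "(sigma (Suc i) M)\<^sup>2 * (cmod ((D S *\<^sub>v w) $ i))\<^sup>2 \<le> c\<^sup>2 * (cmod (w $ i))\<^sup>2"
          using c svd(2)[OF i] i unfolding D_def mat_diag_mult_vec[OF w]
          by (cases "i \<in> S") (auto intro!: mult_right_mono power_mono)
      qed
      also have "\<dots> = (c * vnorm w)\<^sup>2"
        using w by (simp add: power_mult_distrib vnorm_sq sum_distrib_left)
      finally have "vnorm (P S *\<^sub>v u) \<le> c * vnorm w"
        using c(2) by (simp add: power2_le_iff_abs_le)
      then show "vnorm (P S *\<^sub>v u) \<le> c * vnorm u"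
        unfolding w_def by (simp add: vnorm_unitary[OF unitary_mat_adjoint[OF V] u])
    qed (fact c(2))
  qed
qed

lemma op_bound_spec_norm:
  assumes M: "M \<in> carrier_mat m n" and nm: "n \<le> m" and n0: "0 < n"
  shows "op_bound M (spec_norm M)"
proof -
  obtain P where P: "P {..<n} = M"
    "\<And>S c. (\<And>i. i \<in> S \<Longrightarrow> i < n \<Longrightarrow> sigma (Suc i) M \<le> c) \<Longrightarrow> 0 \<le> c \<Longrightarrow> op_bound (P S) c"
    using svd_sections[OF M nm] by metis
  have "op_bound (P {..<n}) (sigma (Suc 0) M)"
    using sigma_svd(2,3)[OF M nm] n0 by (intro P(2)) auto
  then show ?thesis using P(1) by (simp add: spec_norm_def)
qed

subsection \<open>The Sylvester equation\<close>

text \<open>The operator taking \<open>X\<close> to \<open>A X - X B\<close> for diagonal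
  \<open>A\<close> and \<open>B\<close>. In entrywise form it visibly commutes with diagonal
  scalings and is inverted by division.\<close>

definition sylvester :: "nat \<Rightarrow> nat \<Rightarrow> (nat \<Rightarrow> complex) \<Rightarrow> (nat \<Rightarrow> complex) \<Rightarrow> complex mat \<Rightarrow> complex mat" where
  "sylvester m n a b X = mat m n (\<lambda>(i, j). (a i - b j) * X $$ (i, j))"

lemma sylvester_carrier [simp, intro]: "sylvester m n a b X \<in> carrier_mat m n"
  by (simp add: sylvester_def)

lemma sylvester_eq:
  assumes "X \<in> carrier_mat m n"
  shows "sylvester m n a b X = mat_diag m a * X - X * mat_diag n b"
  unfolding mat_diag_mult_left[OF assms] mat_diag_mult_right[OF assms]
  by (intro eq_matI) (auto simp: sylvester_def algebra_simps)

lemma mat_diag_mult_carrier [simp]: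
  "X \<in> carrier_mat m n \<Longrightarrow> mat_diag m c * X \<in> carrier_mat m n"
  "X \<in> carrier_mat m n \<Longrightarrow> X * mat_diag n c \<in> carrier_mat m n"
  using mult_carrier_mat[OF mat_diag_dim] mult_carrier_mat[OF _ mat_diag_dim] by blast+

lemma op_bound_diag_mult:
  assumes "X \<in> carrier_mat m n" "op_bound X d" "\<And>i. i < m \<Longrightarrow> cmod (c i) \<le> e" "0 \<le> e"
  shows "op_bound (mat_diag m c * X) (e * d)"
  by (rule op_bound_mult[OF op_bound_diag[OF assms(3,4)] assms(2) mat_diag_dim assms(1)])

lemma op_bound_mult_diag:
  assumes "X \<in> carrier_mat m n" "op_bound X d" "\<And>j. j < n \<Longrightarrow> cmod (c j) \<le> e" "0 \<le> e"
  shows "op_bound (X * mat_diag n c) (d * e)"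
  by (rule op_bound_mult[OF assms(2) op_bound_diag[OF assms(3,4)] assms(1) mat_diag_dim])

lemma low_rank_scale:
  assumes "X \<in> carrier_mat m n" "low_rank t X"
  shows "low_rank t (mat_diag m c * X * mat_diag n d)"
  by (rule low_rank_mult_right[OF mat_diag_mult_carrier(1)[OF assms(1)] mat_diag_dim
        low_rank_mult_left[OF mat_diag_dim assms]])

lemma scale_eq:
  assumes "X \<in> carrier_mat m n"
  shows "mat_diag m c * X * mat_diag n d = mat m n (\<lambda>(i, j). c i * X $$ (i, j) * d j)"
  unfolding mat_diag_mult_left[OF assms] by (subst mat_diag_mult_right[of _ m]) (auto intro!: eq_matI)

text \<open>The situation after diagonalization: \<open>a\<close> and \<open>b\<close> are the
  diagonals of \<open>A\<close> and \<open>B\<close>. The condition on \<open>- b j\<close> puts the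
  spectrum of \<open>B\<close> into the reflected disk.\<close>

locale disk_spectra =
  fixes m n :: nat and a b :: "nat \<Rightarrow> complex" and z0 \<eta> :: real
  assumes nm: "n \<le> m" and n0: "0 < n" and eta0: "0 < \<eta>" and eta_less: "\<eta> < z0"
    and a_disk: "\<And>i. i < m \<Longrightarrow> cmod (a i - complex_of_real z0) \<le> \<eta>"
    and b_disk: "\<And>j. j < n \<Longrightarrow> cmod (- b j - complex_of_real z0) \<le> \<eta>"
begin

abbreviation "syl \<equiv> sylvester m n a b"

definition "\<phi> = sqrt (z0\<^sup>2 - \<eta>\<^sup>2)"
text \<open>This is \<open>1 / \<mu>\<^sub>1\<close>.\<close>

definition "q = (z0 - \<phi>) / (z0 + \<phi>)"

lemma phi_sq: "\<phi>\<^sup>2 = z0\<^sup>2 - \<eta>\<^sup>2"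
  using eta0 eta_less by (simp add: \<phi>_def power_mono)

lemma phi_pos: "0 < \<phi>"
  using eta0 eta_less by (simp add: \<phi>_def power_strict_mono)

lemma phi_less: "\<phi> < z0"
  by (rule power2_less_imp_less) (use phi_sq eta0 eta_less in auto)

lemma q_pos: "0 < q"
  using phi_pos phi_less by (simp add: q_def)

text \<open>The Moebius map \<open>z \<mapsto> (z - \<phi>) / (z + \<phi>)\<close> sends the disk onto the disk of radius \<open>sqrt q\<close> about \<open>0\<close>.\<close>

lemma disk_moebius:
  assumes "cmod (z - complex_of_real z0) \<le> \<eta>"
  shows "z + complex_of_real \<phi> \<noteq> 0" "cmod ((z - complex_of_real \<phi>) / (z + complex_of_real \<phi>)) \<le> sqrt q"
proof -
  have "\<bar>Re z - z0\<bar> \<le> \<eta>"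
    using abs_Re_le_cmod[of "z - complex_of_real z0"] assms by simp
  then have "0 < Re (z + complex_of_real \<phi>)"
    using phi_pos eta_less by simp
  then show ne: "z + complex_of_real \<phi> \<noteq> 0" by (metis less_irrefl zero_complex.sel(1))
  have "(cmod (z - complex_of_real z0))\<^sup>2 \<le> \<eta>\<^sup>2"
    using assms by (simp add: power_mono)
  then have le: "(Re z)\<^sup>2 + (Im z)\<^sup>2 + \<phi>\<^sup>2 \<le> 2 * z0 * Re z"
    unfolding phi_sq cmod_power2 by (simp add: power2_eq_square algebra_simps)
  \<comment> \<open>The disk condition takes the form \<open>le\<close> after substituting
    \<open>z0^2 - \<eta>^2\<close> for the square of \<open>\<phi>\<close>; this identity turns it
    into a comparison of the two moduli.\<close>
  have "(z0 - \<phi>) * (cmod (z + complex_of_real \<phi>))\<^sup>2 - (z0 + \<phi>) * (cmod (z - complex_of_real \<phi>))\<^sup>2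
      = 2 * \<phi> * (2 * z0 * Re z - ((Re z)\<^sup>2 + (Im z)\<^sup>2 + \<phi>\<^sup>2))"
    unfolding cmod_power2 by (simp add: power2_eq_square algebra_simps)
  also have "\<dots> \<ge> 0"
    using le phi_pos by simp
  finally have "(z0 + \<phi>) * (cmod (z - complex_of_real \<phi>))\<^sup>2 \<le> (z0 - \<phi>) * (cmod (z + complex_of_real \<phi>))\<^sup>2"
    by simp
  then have "(cmod ((z - complex_of_real \<phi>) / (z + complex_of_real \<phi>)))\<^sup>2 \<le> q"
    using ne phi_pos phi_less by (simp add: q_def norm_divide power_divide divide_simps mult.commute)
  then show "cmod ((z - complex_of_real \<phi>) / (z + complex_of_real \<phi>)) \<le> sqrt q"
    by (rule real_le_rsqrt)
qed

lemma disk_bound: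
  assumes "cmod (z - complex_of_real z0) \<le> \<eta>"
  shows "cmod z \<le> z0 + \<eta>"
  using norm_triangle_ineq[of "z - complex_of_real z0" "complex_of_real z0"] assms eta0 eta_less by simp

text \<open>The disks about \<open>z0\<close> and \<open>- z0\<close> are disjoint since
  \<open>\<eta> < z0\<close>: a common point would give
  \<open>2 * z0 \<le> 2 * \<eta>\<close>.\<close>

lemma spectra_disjoint: "i < m \<Longrightarrow> j < n \<Longrightarrow> a i \<noteq> b j"
proof
  assume "i < m" "j < n" "a i = b j"
  then have "cmod ((a i - complex_of_real z0) + (- b j - complex_of_real z0)) \<le> \<eta> + \<eta>"
    by (intro order_trans[OF norm_triangle_ineq] add_mono a_disk b_disk)
  moreover have "(a i - complex_of_real z0) + (- b j - complex_of_real z0) = complex_of_real (- 2 * z0)"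
    using \<open>a i = b j\<close> by simp
  ultimately show False
    using eta0 eta_less by (simp only: norm_of_real)
qed

lemma op_bound_syl:
  assumes X: "X \<in> carrier_mat m n" and c: "op_bound X c"
  shows "op_bound (syl X) (2 * (z0 + \<eta>) * c)"
proof -
  have pos: "0 \<le> z0 + \<eta>" using eta0 eta_less by simp
  have b_bound: "cmod (b j) \<le> z0 + \<eta>" if "j < n" for j
    using disk_bound[OF b_disk[OF that]] by simp
  have "op_bound (mat_diag m a * X - X * mat_diag n b) ((z0 + \<eta>) * c + c * (z0 + \<eta>))"
    using disk_bound[OF a_disk] b_bound pos X
    by (intro op_bound_diff[of _ _ _ _ m n] op_bound_diag_mult[of _ m n] op_bound_mult_diag[of _ m n] c) auto
  then show ?thesis
    by (simp add: sylvester_eq[OF X] algebra_simps)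
qed

text \<open>Writing \<open>A = z0 + A'\<close> and \<open>B = - z0 + B'\<close> with \<open>\<parallel>A'\<parallel>, \<parallel>B'\<parallel> \<le> \<eta>\<close>, the Sylvester equation becomes
  \<open>2 z0 X = F - A' X + X B'\<close>.\<close>

lemma op_bound_syl_inverse:
  assumes X: "X \<in> carrier_mat m n" and f: "op_bound (syl X) f"
  shows "op_bound X (f / (2 * (z0 - \<eta>)))"
proof -
  define c where "c = spec_norm X"
  \<comment> \<open>\<open>Y\<close> is \<open>A' X\<close> and \<open>Z\<close> is
    \<open>- X B'\<close>, so that \<open>syl X - (Y + Z)\<close> equals
    \<open>2 z0 X\<close>.\<close>
  define Y where "Y = mat_diag m (\<lambda>i. a i - complex_of_real z0) * X"
  define Z where "Z = X * mat_diag n (\<lambda>j. - b j - complex_of_real z0)"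
  have c: "op_bound X c" unfolding c_def by (rule op_bound_spec_norm[OF X nm n0])
  have Y: "Y \<in> carrier_mat m n" and Z: "Z \<in> carrier_mat m n"
    using X by (auto simp: Y_def Z_def)
  have "op_bound Y (\<eta> * c)" "op_bound Z (c * \<eta>)"
    unfolding Y_def Z_def using a_disk b_disk eta0 X
    by (auto intro!: op_bound_diag_mult[of _ m n] op_bound_mult_diag[of _ m n] c)
  then have "op_bound (syl X - (Y + Z)) (f + (\<eta> * c + c * \<eta>))"
    by (intro op_bound_diff[of _ _ _ _ m n] op_bound_add[of _ _ _ _ m n] f Y Z) (use Y Z in auto)
  then have "op_bound (complex_of_real (1 / (2 * z0)) \<cdot>\<^sub>m (syl X - (Y + Z)))
      (cmod (complex_of_real (1 / (2 * z0))) * (f + (\<eta> * c + c * \<eta>)))"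
    by (rule op_bound_smult)
  moreover have "complex_of_real (1 / (2 * z0)) \<cdot>\<^sub>m (syl X - (Y + Z)) = X"
  proof -
    have "z0 \<noteq> 0" using eta0 eta_less by simp
    then show ?thesis
      unfolding Y_def Z_def mat_diag_mult_left[OF X] mat_diag_mult_right[OF X] using X
      by (intro eq_matI) (auto simp: sylvester_def field_simps)
  qed
  ultimately have "op_bound X (1 / (2 * z0) * (f + (\<eta> * c + c * \<eta>)))"
    using eta0 eta_less by (simp add: norm_divide)
  \<comment> \<open>With \<open>c\<close> the exact norm of \<open>X\<close>, the bound contains
    \<open>c\<close> on both sides and can be solved for it because
    \<open>\<eta> < z0\<close>.\<close>
  then have "c \<le> 1 / (2 * z0) * (f + (\<eta> * c + c * \<eta>))"
    unfolding c_def by (rule spec_norm_le[OF X nm n0])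
  then have "c \<le> f / (2 * (z0 - \<eta>))"
    using eta0 eta_less by (simp add: field_simps)
  with c show ?thesis by (rule op_bound_mono)
qed

text \<open>One ADI step replaces \<open>X\<close> by \<open>X' = s(A) X s(B)\<^sup>-\<^sup>1\<close> with \<open>s(z) = (z - \<phi>) / (z + \<phi>)\<close>; then
  \<open>X - X'\<close> is \<open>- 2 \<phi> (A + \<phi>)\<^sup>-\<^sup>1 F (B - \<phi>)\<^sup>-\<^sup>1\<close>.\<close>

lemma adi_approx:
  assumes "X \<in> carrier_mat m n" "low_rank 1 (syl X)" "op_bound X c"
  shows "\<exists>Y\<in>carrier_mat m n. low_rank i Y \<and> op_bound (X - Y) (q ^ i * c)"
  using assms
proof (induction i arbitrary: X c)
  case 0
  have "X - 0\<^sub>m m n = X" using 0(1) by (intro eq_matI) auto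
  then show ?case
    using 0 by (intro bexI[of _ "0\<^sub>m m n"]) (auto simp: low_rank_zero)
next
  case (Suc i)
  define p where "p = complex_of_real \<phi>"
  define s where "s i = (a i - p) / (a i + p)" for i
  \<comment> \<open>This is \<open>1 / s(b j)\<close>. Since \<open>1 / s(z) = s(- z)\<close>, the
    disk bound for \<open>- b j\<close> applies to it.\<close>
  define r where "r j = (b j + p) / (b j - p)" for j
  define X' where "X' = mat_diag m s * X * mat_diag n r"
  have X: "X \<in> carrier_mat m n" by fact
  have X': "X' \<in> carrier_mat m n" using X by (auto simp: X'_def)
  have s: "a i + p \<noteq> 0" "cmod (s i) \<le> sqrt q" if "i < m" for i
    using disk_moebius[OF a_disk[OF that]] by (auto simp: s_def p_def)
  have r: "b j - p \<noteq> 0" "cmod (r j) \<le> sqrt q" if "j < n" for j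
  proof -
    note d = disk_moebius[OF b_disk[OF that], folded p_def]
    from d(1) show "b j - p \<noteq> 0" by auto
    have "r j = (- b j - p) / (- b j + p)"
      unfolding r_def by (metis minus_diff_eq minus_divide_divide minus_add_distrib diff_conv_add_uminus add.commute minus_minus)
    then show "cmod (r j) \<le> sqrt q" using d(2) by simp
  qed
  have "op_bound X' (sqrt q * c * sqrt q)"
    unfolding X'_def using s r q_pos X Suc.prems(3)
    by (intro op_bound_diag_mult[of _ m n] op_bound_mult_diag[of _ m n]) auto
  moreover have "sqrt q * c * sqrt q = q * c"
    using q_pos by (simp add: mult.commute mult.left_commute flip: mult.assoc)
  ultimately have bX': "op_bound X' (q * c)" by simp
  \<comment> \<open>Diagonal scalings commute with \<open>syl\<close>, so the right-hand side for
    \<open>X'\<close> still has rank at most one and the induction hypothesis applies with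
    \<open>q * c\<close> in place of \<open>c\<close>.\<close>
  have "syl X' = mat_diag m s * syl X * mat_diag n r"
    unfolding X'_def scale_eq[OF X] scale_eq[OF sylvester_carrier]
    by (intro eq_matI) (auto simp: sylvester_def)
  then have "low_rank 1 (syl X')"
    by (simp only:) (rule low_rank_scale[OF sylvester_carrier Suc.prems(2)])
  from Suc.IH[OF X' this bX'] obtain Y where Y: "Y \<in> carrier_mat m n" "low_rank i Y"
    "op_bound (X' - Y) (q ^ i * (q * c))" by blast
  have "X - X' = (- 2 * p) \<cdot>\<^sub>m (mat_diag m (\<lambda>i. 1 / (a i + p)) * syl X * mat_diag n (\<lambda>j. 1 / (b j - p)))"
    unfolding X'_def scale_eq[OF X] scale_eq[OF sylvester_carrier] using X
  proof (intro eq_matI, goal_cases)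
    case (1 i j)
    then have ij: "i < m" "j < n" by auto
    \<comment> \<open>Over the common denominator this is
      \<open>(a + p) (b - p) - (a - p) (b + p) = - 2 p (a - b)\<close>.\<close>
    have "x - (a i - p) / (a i + p) * x * ((b j + p) / (b j - p)) = - 2 * p * (1 / (a i + p) * ((a i - b j) * x) * (1 / (b j - p)))" for x
      using s(1)[OF ij(1)] r(1)[OF ij(2)] by (simp add: divide_simps) (simp add: algebra_simps)
    then show ?case
      using ij X by (simp add: sylvester_def s_def r_def)
  qed auto
  then have "low_rank 1 (X - X')"
    by (simp only:) (rule low_rank_smult[OF mat_diag_mult_carrier(2)[OF mat_diag_mult_carrier(1)[OF sylvester_carrier]]
          low_rank_scale[OF sylvester_carrier Suc.prems(2)]])
  then have "low_rank (1 + i) ((X - X') + Y)"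
    using X X' Y by (intro low_rank_add[of _ m n]) auto
  moreover have "X - ((X - X') + Y) = X' - Y"
    using X X' Y(1) by (intro eq_matI) auto
  ultimately show ?case
    using X X' Y by (intro bexI[of _ "(X - X') + Y"]) (auto simp: mult.assoc mult.commute mult.left_commute)
qed

section \<open>Decay of the singular values of the solution\<close>

lemma approx_add:
  assumes "\<exists>Y\<in>carrier_mat m n. low_rank s Y \<and> op_bound (X1 - Y) c"
    "\<exists>Y\<in>carrier_mat m n. low_rank t Y \<and> op_bound (X2 - Y) d"
    "X1 \<in> carrier_mat m n" "X2 \<in> carrier_mat m n"
  shows "\<exists>Y\<in>carrier_mat m n. low_rank (s + t) Y \<and> op_bound (X1 + X2 - Y) (c + d)"
proof -
  obtain Y1 Y2 where Y: "Y1 \<in> carrier_mat m n" "low_rank s Y1" "op_bound (X1 - Y1) c"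
    "Y2 \<in> carrier_mat m n" "low_rank t Y2" "op_bound (X2 - Y2) d"
    using assms by blast
  have "X1 + X2 - (Y1 + Y2) = (X1 - Y1) + (X2 - Y2)"
    using assms(3,4) Y(1,4) by (intro eq_matI) auto
  then show ?thesis
    using Y assms(3,4) 
    by (intro bexI[of _ "Y1 + Y2"]) (auto intro!: low_rank_add[of _ m n] op_bound_add[of _ _ _ _ m n])
qed

text \<open>The rank-one piece of \<open>F\<close> belonging to \<open>\<sigma>\<^sub>j\<^sub>+\<^sub>1(F)\<close> receives \<open>k - j\<close> ADI steps, and the tail
  beyond \<open>k\<close> none.\<close>

lemma sigma_decay:
  assumes X: "X \<in> carrier_mat m n" and kn: "k < n" and tn: "(\<Sum>j<k. k - j) < n"
  shows "sigma (Suc (\<Sum>j<k. k - j)) X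
    \<le> ((\<Sum>j<k. q ^ (k - j) * sigma (Suc j) (syl X)) + sigma (Suc k) (syl X)) / (2 * (z0 - \<eta>))"
proof -
  define F where "F = syl X"
  have F: "F \<in> carrier_mat m n" by (simp add: F_def)
  note svd = sigma_svd(2,3)[OF F nm]
  obtain P where P: "\<And>S. P S \<in> carrier_mat m n" "P {..<n} = F"
    "\<And>S T. S \<inter> T = {} \<Longrightarrow> P (S \<union> T) = P S + P T"
    "\<And>i. i < n \<Longrightarrow> low_rank 1 (P {i})"
    "\<And>S c. (\<And>i. i \<in> S \<Longrightarrow> i < n \<Longrightarrow> sigma (Suc i) F \<le> c) \<Longrightarrow> 0 \<le> c \<Longrightarrow> op_bound (P S) c"
    using svd_sections[OF F nm] by metis
  \<comment> \<open>\<open>R S\<close> solves the Sylvester equation with right-hand side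
    \<open>P S\<close>; the denominators are nonzero by \<open>spectra_disjoint\<close>.\<close>
  define R where "R S = mat m n (\<lambda>(i, j). P S $$ (i, j) / (a i - b j))" for S
  have R: "R S \<in> carrier_mat m n" for S by (simp add: R_def)
  have sylR: "syl (R S) = P S" for S
    using P(1)[of S] spectra_disjoint by (intro eq_matI) (auto simp: sylvester_def R_def)
  have R_Un: "R (S \<union> T) = R S + R T" if "S \<inter> T = {}" for S T
    using P(1)[of S] P(1)[of T] by (intro eq_matI) (auto simp: R_def P(3)[OF that] add_divide_distrib)
  have R_all: "R {..<n} = X"
    using X spectra_disjoint unfolding R_def P(2) F_def by (intro eq_matI) (auto simp: sylvester_def)
  define d where "d = 2 * (z0 - \<eta>)"
  \<comment> \<open>Induction on the number \<open>l\<close> of rank-one pieces treated so far;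
    \<open>l \<le> k\<close> keeps their indices below \<open>n\<close>.\<close>
  have head: "\<exists>Y\<in>carrier_mat m n. low_rank (\<Sum>j<l. k - j) Y \<and>
      op_bound (R {..<l} - Y) (\<Sum>j<l. q ^ (k - j) * (sigma (Suc j) F / d))" if "l \<le> k" for l
    using that
  proof (induction l)
    case 0
    \<comment> \<open>The empty set is disjoint from itself, so additivity alone forces
      \<open>P {}\<close> to vanish.\<close>
    have "P {} = P {} + P {}" using P(3)[of "{}" "{}"] by simp
    then have "P {} $$ (i, j) = P {} $$ (i, j) + P {} $$ (i, j)" if "i < m" "j < n" for i j
      using P(1)[of "{}"] that by (metis index_add_mat(1) carrier_matD)
    then have "R {} - 0\<^sub>m m n = 0\<^sub>m m n"
      by (intro eq_matI) (auto simp: R_def)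
    then show ?case
      by (intro bexI[of _ "0\<^sub>m m n"]) (auto simp: low_rank_zero op_bound_zero)
  next
    case (Suc l)
    then have l: "l < n" using kn by simp
    have "op_bound (syl (R {l})) (sigma (Suc l) F)"
      unfolding sylR using svd(1)[OF l] by (intro P(5)) auto
    then have "op_bound (R {l}) (sigma (Suc l) F / d)"
      unfolding d_def by (rule op_bound_syl_inverse[OF R])
    moreover have "low_rank 1 (syl (R {l}))"
      unfolding sylR by (rule P(4)[OF l])
    ultimately have "\<exists>Y\<in>carrier_mat m n. low_rank (k - l) Y \<and> op_bound (R {l} - Y) (q ^ (k - l) * (sigma (Suc l) F / d))"
      by (intro adi_approx R)
    moreover have "R {..<Suc l} = R {..<l} + R {l}"
      using R_Un[of "{..<l}" "{l}"] by (simp add: lessThan_Suc)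
    ultimately show ?case
      unfolding sum.lessThan_Suc by (simp only:) (rule approx_add[OF Suc.IH _ R R], use Suc.prems in auto)
  qed
  \<comment> \<open>The largest singular value in the tail is the one with index
    \<open>Suc k\<close>.\<close>
  have "op_bound (syl (R {k..<n})) (sigma (Suc k) F)"
    unfolding sylR using svd(1)[OF kn] svd(2) by (intro P(5)) auto
  then have "op_bound (R {k..<n}) (sigma (Suc k) F / d)"
    unfolding d_def by (rule op_bound_syl_inverse[OF R])
  then have tail: "\<exists>Y\<in>carrier_mat m n. low_rank 0 Y \<and> op_bound (R {k..<n} - Y) (sigma (Suc k) F / d)"
  proof (intro bexI[of _ "0\<^sub>m m n"] conjI low_rank_zero)
    have "R {k..<n} - 0\<^sub>m m n = R {k..<n}"
      using R[of "{k..<n}"] by (intro eq_matI) auto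
    with \<open>op_bound (R {k..<n}) _\<close> show "op_bound (R {k..<n} - 0\<^sub>m m n) (sigma (Suc k) F / d)"
      by simp
  qed simp
  have "X = R {..<k} + R {k..<n}"
    using R_Un[of "{..<k}" "{k..<n}"] kn R_all by (simp add: ivl_disj_un(8) ivl_disj_int lessThan_atLeast0 ivl_disj_un_two(3))
  then obtain Y where "Y \<in> carrier_mat m n" "low_rank (\<Sum>j<k. k - j) Y"
    "op_bound (X - Y) ((\<Sum>j<k. q ^ (k - j) * (sigma (Suc j) F / d)) + sigma (Suc k) F / d)"
    using approx_add[OF head[OF order_refl] tail R R] by auto
  then have "sigma (Suc (\<Sum>j<k. k - j)) X \<le> (\<Sum>j<k. q ^ (k - j) * (sigma (Suc j) F / d)) + sigma (Suc k) F / d"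
    by (intro sigma_le_op_bound[OF X _ nm tn])
  then show ?thesis
    by (simp add: F_def d_def sum_divide_distrib add_divide_distrib)
qed

text \<open>The step counts are balanced: \<open>q ^ (k - j) * q ^ j = q ^ k\<close> bounds each of
  the \<open>k\<close> head terms in \<open>sigma_decay\<close> by the same quantity as the tail,
  which accounts for the factor \<open>k + 1\<close>.\<close>

lemma triangular_decay:
  assumes X: "X \<in> carrier_mat m n" and K: "0 \<le> K" and k0: "0 < k" and t: "t = k * (k + 1) div 2" and tn: "t < n"
    and decay: "\<And>j. j < n \<Longrightarrow> sigma (Suc j) (syl X) \<le> K * q ^ j * spec_norm (syl X)"
  shows "sigma (Suc t) X \<le> K * ((z0 + \<eta>) / (z0 - \<eta>)) * (real k + 1) * q ^ k * spec_norm X"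
proof -
  define f where "f = spec_norm (syl X)"
  define d where "d = 2 * (z0 - \<eta>)"
  have d: "0 < d" using eta_less by (simp add: d_def)
  have t_sum: "(\<Sum>j<k. k - j) = t"
  proof -
    have "(\<Sum>j<k. k - j) = (\<Sum>j<k. Suc j)"
      by (rule sum.reindex_bij_witness[of _ "\<lambda>j. k - Suc j" "\<lambda>j. k - Suc j"]) auto
    also have "2 * \<dots> = k * (k + 1)"
      by (induction k) auto
    then have "(\<Sum>j<k. Suc j) = t" using t by simp
    finally show ?thesis .
  qed
  \<comment> \<open>This gives \<open>k < n\<close>, so the decay hypothesis is available at
    \<open>j = k\<close> for the tail.\<close>
  have "k \<le> t"
    using k0 t by (cases k) auto
  then have kn: "k < n" using tn by simp
  have "sigma (Suc t) X \<le> ((\<Sum>j<k. q ^ (k - j) * sigma (Suc j) (syl X)) + sigma (Suc k) (syl X)) / d"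
    using sigma_decay[OF X kn] tn unfolding t_sum d_def by simp
  also have "\<dots> \<le> ((\<Sum>j<k. q ^ (k - j) * (K * q ^ j * f)) + K * q ^ k * f) / d"
    unfolding f_def using kn q_pos d
    by (intro divide_right_mono add_mono sum_mono mult_left_mono decay) auto
  also have "(\<Sum>j<k. q ^ (k - j) * (K * q ^ j * f)) = (\<Sum>j<k. K * q ^ k * f)"
    by (rule sum.cong) (auto simp: mult.assoc mult.left_commute simp flip: power_add)
  also have "((\<Sum>j<k. K * q ^ k * f) + K * q ^ k * f) / d = K * (real k + 1) * q ^ k / d * f"
    by (simp add: algebra_simps)
  \<comment> \<open>The norm of \<open>syl X\<close> is at most \<open>2 * (z0 + \<eta>)\<close>
    times that of \<open>X\<close>; divided by \<open>d\<close> this gives the quotient in the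
    constant.\<close>
  also have "\<dots> \<le> K * (real k + 1) * q ^ k / d * (2 * (z0 + \<eta>) * spec_norm X)"
    unfolding f_def using K q_pos d
    by (intro mult_left_mono spec_norm_le[OF sylvester_carrier nm n0] op_bound_syl[OF X] op_bound_spec_norm[OF X nm n0]) auto
  also have "\<dots> = K * ((z0 + \<eta>) / (z0 - \<eta>)) * (real k + 1) * q ^ k * spec_norm X"
    using eta_less by (simp add: d_def field_simps)
  finally show ?thesis .
qed

end

section \<open>Unitary invariance and return to the original matrices\<close>

lemma sigma_unitary_invariant:
  assumes M: "M \<in> carrier_mat m n" and U: "unitary_mat m U" and W: "unitary_mat n W"
  shows "sigma j (mat_adjoint U * M * W) = sigma j M"
proof -
  note u = unitary_matD[OF U] and w = unitary_matD[OF W]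
  let ?N = "mat_adjoint U * M * W"
  have dims [simp]: "dim_row M = m" "dim_col M = n" "dim_row U = m" "dim_col U = m" "dim_row W = n" "dim_col W = n"
    using M u(1) w(1) by auto
  have "mat_adjoint ?N * ?N = mat_adjoint W * (mat_adjoint M * M) * W"
    by (simp add: mat_simps unitary_cancel_left[OF U])
  moreover have G: "mat_adjoint M * M \<in> carrier_mat n n"
    by (rule mult_carrier_mat[OF mat_adjoint_carrier[OF M] M])
  moreover have "similar_mat (mat_adjoint W * (mat_adjoint M * M) * W) (mat_adjoint M * M)"
    using similar_mat_witI[OF w(2,3) refl mult_carrier_mat[OF mult_carrier_mat[OF w(4) G] w(1)] G w(4,1)]
    unfolding similar_mat_def by blast
  ultimately have "char_poly (mat_adjoint ?N * ?N) = char_poly (mat_adjoint M * M)"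
    using char_poly_similar by metis
  \<comment> \<open>The chosen list depends only on the size and the characteristic polynomial, so
    both matrices get literally the same list.\<close>
  then have "eigvals_list (mat_adjoint ?N * ?N) = eigvals_list (mat_adjoint M * M)"
    by (simp add: eigvals_list_def)
  then show ?thesis
    by (simp add: sigma_def sing_vals_list_def)
qed

theorem theorem4:
  fixes m n :: nat and A B X F :: "complex mat" and z0 \<eta> K :: real
  defines "\<phi> \<equiv> sqrt (z0\<^sup>2 - \<eta>\<^sup>2)"
  defines "\<mu>1 \<equiv> (z0 + \<phi>) / (z0 - \<phi>)"
  assumes "m \<ge> n"
    and "A \<in> carrier_mat m m" and "B \<in> carrier_mat n n" and "X \<in> carrier_mat m n"
    and "normal_mat A" and "normal_mat B"
    and "A * X - X * B = F"
    and "0 < \<eta>" and "\<eta> < z0"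
    and "\<And>ev. eigenvalue A ev \<Longrightarrow> cmod (ev - complex_of_real z0) \<le> \<eta>"
    and "\<And>ev. eigenvalue B ev \<Longrightarrow> cmod (- ev - complex_of_real z0) \<le> \<eta>"
    and "K \<ge> 1"
    and "\<And>j. j < n \<Longrightarrow> sigma (j + 1) F \<le> K * \<mu>1 powr (- real j) * spec_norm F"
  shows "\<forall>k t. k > 0 \<longrightarrow> t = k * (k + 1) div 2 \<longrightarrow> 1 \<le> t \<longrightarrow> t < n \<longrightarrow>
           sigma (t + 1) X \<le> K * ((z0 + \<eta>) / (z0 - \<eta>)) * (3 / 2 * sqrt (real t) + 1)
             * \<mu>1 powr (- ((sqrt (8 * real t + 1) - 1) / 2)) * spec_norm X"
proof (intro allI impI)
  fix k t :: nat
  assume k0: "k > 0" and t: "t = k * (k + 1) div 2" and "1 \<le> t" and tn: "t < n"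
  note A = assms(4) and B = assms(5) and X = assms(6) and nm = assms(3)
  obtain U where U: "unitary_mat m U" and UA: "mat_adjoint U * A * U = mat_diag m (\<lambda>i. eigvals_list A ! i)"
    using normal_mat_unitary_diag[OF A assms(7) eigvals_list(2)[OF A]] by blast
  obtain W where W: "unitary_mat n W" and WB: "mat_adjoint W * B * W = mat_diag n (\<lambda>i. eigvals_list B ! i)"
    using normal_mat_unitary_diag[OF B assms(8) eigvals_list(2)[OF B]] by blast
  note u = unitary_matD[OF U] and w = unitary_matD[OF W]
  define X' where "X' = mat_adjoint U * X * W"
  have X': "X' \<in> carrier_mat m n" using X u(4) w(1) by (auto simp: X'_def)
  interpret disk_spectra m n "\<lambda>i. eigvals_list A ! i" "\<lambda>i. eigvals_list B ! i" z0 \<eta>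
  proof
    show "cmod (eigvals_list A ! i - complex_of_real z0) \<le> \<eta>" if "i < m" for i
      using that eigvals_list(1)[OF A] by (intro assms(12) eigvals_list_eigenvalue[OF A]) simp
    show "cmod (- (eigvals_list B ! j) - complex_of_real z0) \<le> \<eta>" if "j < n" for j
      using that eigvals_list(1)[OF B] by (intro assms(13) eigvals_list_eigenvalue[OF B]) simp
  qed (use assms(3,10,11) tn in auto)
  have F: "F \<in> carrier_mat m n"
    unfolding assms(9)[symmetric] using A B X by auto
  \<comment> \<open>The transformed right-hand side is unitarily equivalent to \<open>F\<close>, so
    the assumed singular value decay carries over.\<close>
  have "syl X' = mat_adjoint U * F * W"
  proof -
    have dims [simp]: "dim_row A = m" "dim_col A = m" "dim_row B = n" "dim_col B = n" "dim_row X = m" "dim_col X = n"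
      "dim_row U = m" "dim_col U = m" "dim_row W = n" "dim_col W = n"
      using A B X u(1) w(1) by auto
    have "syl X' = (mat_adjoint U * A * U) * X' - X' * (mat_adjoint W * B * W)"
      unfolding sylvester_eq[OF X'] UA WB ..
    also have "\<dots> = mat_adjoint U * (A * X) * W - mat_adjoint U * (X * B) * W"
      by (simp add: X'_def mat_simps unitary_cancel_left[OF U] unitary_cancel_left[OF W])
    also have "\<dots> = mat_adjoint U * (A * X - X * B) * W"
      using A B X u(4) w(1) 
      by (simp add: minus_mult_distrib_mat[of _ m n _ _ n] mult_minus_distrib_mat[of _ m m _ n])
    finally show ?thesis by (simp add: assms(9))
  qed
  then have sigF: "sigma j (syl X') = sigma j F" for j
    by (simp add: sigma_unitary_invariant[OF F U W])
  have sigX: "sigma j X' = sigma j X" for j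
    unfolding X'_def by (rule sigma_unitary_invariant[OF X U W])
  have phi: "\<phi> = disk_spectra.\<phi> z0 \<eta>"
    by (simp add: assms(1) \<phi>_def)
  have mu: "\<mu>1 > 0" "inverse \<mu>1 = q"
    using phi_pos phi_less unfolding assms(2) phi q_def by (auto simp: divide_simps)
  have pw: "\<mu>1 powr (- real j) = q ^ j" for j
    using mu(1) by (simp add: powr_minus powr_realpow power_inverse flip: mu(2))
  have main: "sigma (Suc t) X \<le> K * ((z0 + \<eta>) / (z0 - \<eta>)) * (real k + 1) * q ^ k * spec_norm X"
    using triangular_decay[OF X' _ k0 t tn, of K] assms(14,15) 
    by (simp add: sigX sigF spec_norm_def pw)
  have "even (k * (k + 1))" by simp
  then have "2 * t = k * (k + 1)" using t by simp
  then have t2: "2 * real t = real k * (real k + 1)"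
    by (metis of_nat_1 of_nat_add of_nat_mult of_nat_numeral)
  \<comment> \<open>For \<open>2 t = k (k + 1)\<close> the number \<open>8 t + 1\<close> is the
    square of \<open>2 k + 1\<close>, so the exponent of \<open>\<mu>1\<close> in the claim is
    \<open>- k\<close>.\<close>
  have "sqrt (8 * real t + 1) = 2 * real k + 1"
    by (rule real_sqrt_unique) (use t2 in \<open>auto simp: power2_eq_square algebra_simps\<close>)
  then have e: "(sqrt (8 * real t + 1) - 1) / 2 = real k" by simp
  \<comment> \<open>From \<open>k^2 \<le> 2 t \<le> 9/4 t\<close>; this is where the constant 3/2
    comes from.\<close>
  have "(2 / 3 * real k)\<^sup>2 \<le> real t"
    using t2 k0 by (simp add: power2_eq_square field_simps)
  then have "2 / 3 * real k \<le> sqrt (real t)"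
    by (rule real_le_rsqrt)
  then have "real k + 1 \<le> 3 / 2 * sqrt (real t) + 1" by simp
  moreover have "0 \<le> spec_norm X"
    using sigma_svd(2)[OF X nm, of 0] tn by (simp add: spec_norm_def)
  ultimately have "K * ((z0 + \<eta>) / (z0 - \<eta>)) * (real k + 1) * q ^ k * spec_norm X
      \<le> K * ((z0 + \<eta>) / (z0 - \<eta>)) * (3 / 2 * sqrt (real t) + 1) * q ^ k * spec_norm X"
    using assms(14) eta0 eta_less q_pos by (intro mult_right_mono mult_left_mono) auto
  with main show "sigma (t + 1) X \<le> K * ((z0 + \<eta>) / (z0 - \<eta>)) * (3 / 2 * sqrt (real t) + 1)
             * \<mu>1 powr (- ((sqrt (8 * real t + 1) - 1) / 2)) * spec_norm X"
    by (simp add: e pw)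
qed

end
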